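(* Let $v_0$ be an arbitrary vertex in $K_n$. Given an edge ordering $f$ of the edges of $K_n$, let the greedy $f$-increasing path from $v_0$ be the path $v_0v_1v_2\ldots v_t$ with the following properties: (i) $v_0v_1$ is the lowest-labeled edge incident to $v_0$; (ii) for each $1\le i\le t-1$, $v_{i+1}$ is the vertex $x$ which minimizes the label of $v_ix$ over all $x\notin\{v_0,v_1,\ldots,v_i\}$ such that the label of $v_ix$ exceeds the label of $v_{i-1}v_i$; and (iii) every vertex $x\notin\{v_0,\ldots,v_t\}$ has $v_tx$ labeled below $v_{t-1}v_t$. Then, if $f$ is chosen uniformly at random, the length of the greedy $f$-increasing path from $v_0$ is $(1-\frac1e+o(1))n$ asymptotically almost surely.
   Context: An edge ordering of $K_n$ is a bijection $f:E(K_n)\to\{1,2,\dots,\binom n2\}$; $f(e)$ is the label of $e$. The length of a path is its number of edges. "Asymptotically almost surely" means with probability $1-o(1)$ as $n\to\infty$. *)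

theory Defs
  imports "HOL-Probability.Probability" "HOL-Library.Landau_Symbols"
begin

text \<open>The complete graph \<open>K\<^sub>n\<close> has vertex set \<open>{..<n}\<close>; its edges are the two-element sets of vertices.\<close>

definition complete_edges :: "nat \<Rightarrow> nat set set" where
  "complete_edges n = {e. e \<subseteq> {..<n} \<and> card e = 2}"

text \<open>Functions are taken extensional (undefined off the edge set), so that distinct members
  are distinct edge orderings and the set is finite.\<close>

definition edge_orderings :: "nat \<Rightarrow> (nat set \<Rightarrow> nat) set" where
  "edge_orderings n =
     {f \<in> extensional (complete_edges n). bij_betw f (complete_edges n) {1..n choose 2}}"

text \<open>A path \<open>v\<^sub>0 v\<^sub>1 \<dots> v\<^sub>t\<close> is given by the list of its \<open>t + 1\<close> vertices; the condition
  \<open>2 \<le> length vs\<close> is \<open>t \<ge> 1\<close>, which is implicit in the first edge \<open>v\<^sub>0 v\<^sub>1\<close>.\<close>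

definition is_greedy_path :: "nat \<Rightarrow> (nat set \<Rightarrow> nat) \<Rightarrow> nat \<Rightarrow> nat list \<Rightarrow> bool" where
  "is_greedy_path n f v vs \<longleftrightarrow>
     2 \<le> length vs \<and> distinct vs \<and> set vs \<subseteq> {..<n} \<and> vs ! 0 = v \<and>
     is_arg_min (\<lambda>x. f {v, x}) (\<lambda>x. x \<in> {..<n} - {v}) (vs ! 1) \<and>
     (\<forall>i. 1 \<le> i \<and> i + 1 < length vs \<longrightarrow>
        is_arg_min (\<lambda>x. f {vs ! i, x})
          (\<lambda>x. x \<in> {..<n} - set (take (i + 1) vs) \<and> f {vs ! i, x} > f {vs ! (i - 1), vs ! i})
          (vs ! (i + 1))) \<and>
     (\<forall>x \<in> {..<n} - set vs.
        f {vs ! (length vs - 1), x} < f {vs ! (length vs - 2), vs ! (length vs - 1)})"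

definition greedy_path :: "nat \<Rightarrow> (nat set \<Rightarrow> nat) \<Rightarrow> nat \<Rightarrow> nat list" where
  "greedy_path n f v = (THE vs. is_greedy_path n f v vs)"

definition path_length :: "nat list \<Rightarrow> nat" where
  "path_length vs = length vs - 1"

lemma finite_complete_edges: "finite (complete_edges n)"
  unfolding complete_edges_def by (rule finite_subset[of _ "Pow {..<n}"]) auto

lemma card_complete_edges: "card (complete_edges n) = n choose 2"
  unfolding complete_edges_def using n_subsets[of "{..<n}" 2] by simp

lemma finite_edge_orderings: "finite (edge_orderings n)"
proof (rule finite_subset)
  show "edge_orderings n \<subseteq> complete_edges n \<rightarrow>\<^sub>E {1..n choose 2}"
    unfolding edge_orderings_def by (auto simp: PiE_def bij_betw_def)
  show "finite (complete_edges n \<rightarrow>\<^sub>E {1..n choose 2})"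
    by (rule finite_PiE) (auto simp: finite_complete_edges)
qed

lemma edge_orderings_nonempty: "edge_orderings n \<noteq> {}"
proof -
  obtain g where g: "bij_betw g (complete_edges n) {1..n choose 2}"
    using finite_same_card_bij[of "complete_edges n" "{1..n choose 2}"]
    by (auto simp: finite_complete_edges card_complete_edges)
  have "restrict g (complete_edges n) \<in> edge_orderings n"
    unfolding edge_orderings_def
    using g by (auto cong: bij_betw_cong)
  then show ?thesis by blast
qed

lemma edge_in_complete_edges:
  "a < n \<Longrightarrow> b < n \<Longrightarrow> a \<noteq> b \<Longrightarrow> {a, b} \<in> complete_edges n"
  unfolding complete_edges_def by auto

lemma edge_label_eqD:
  assumes "f \<in> edge_orderings n" "a < n" "b < n" "c < n" "d < n" "a \<noteq> b" "c \<noteq> d"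
    "f {a, b} = f {c, d}"
  shows "{a, b} = {c, d}"
  using assms edge_in_complete_edges[of a n b] edge_in_complete_edges[of c n d]
  unfolding edge_orderings_def bij_betw_def inj_on_def by blast

lemma is_arg_min_label_unique:
  assumes f: "f \<in> edge_orderings n" and "a < n"
    and x: "is_arg_min (\<lambda>x. f {a, x}) P x" and y: "is_arg_min (\<lambda>x. f {a, x}) P y"
    and P: "\<And>z. P z \<Longrightarrow> z < n \<and> z \<noteq> a"
  shows "x = y"
proof -
  have "P x" "P y" "f {a, x} = f {a, y}"
    using x y unfolding is_arg_min_def by (auto simp: not_less intro: antisym)
  then have "{a, x} = {a, y}" using edge_label_eqD[OF f] P \<open>a < n\<close> by metis
  then show ?thesis by (auto simp: doubleton_eq_iff)
qed

lemma is_arg_min_nat_exists: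
  fixes g :: "'a \<Rightarrow> nat"
  shows "P x \<Longrightarrow> \<exists>y. is_arg_min g P y"
  using ex_has_least_nat[of P x g] unfolding is_arg_min_def by (meson not_less)

lemma greedy_paths_agree:
  assumes f: "f \<in> edge_orderings n"
    and vs: "is_greedy_path n f v vs" and ws: "is_greedy_path n f v ws"
  shows "i < length vs \<Longrightarrow> i < length ws \<Longrightarrow> vs ! i = ws ! i"
proof (induction i rule: less_induct)
  case (less i)
  have vn: "v < n" using vs unfolding is_greedy_path_def
    by (metis lessThan_iff less_le_trans nth_mem pos2 subsetD)
  consider "i = 0" | "i = 1" | j where "i = j + 1" "1 \<le> j"
    by (metis Suc_eq_plus1 add_0 less_one not_less old.nat.exhaust)
  then show ?case
  proof cases
    case 1
    then show ?thesis using vs ws by (simp add: is_greedy_path_def)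
  next
    case 2
    then show ?thesis
      using is_arg_min_label_unique[OF f vn] vs ws unfolding is_greedy_path_def
      by (metis (no_types, lifting) DiffE insertI1 lessThan_iff)
  next
    case (3 j)
    have j: "vs ! j = ws ! j" "vs ! (j - 1) = ws ! (j - 1)"
      using less 3 by auto
    have t: "take (j + 1) vs = take (j + 1) ws"
      using less 3 by (intro nth_take_lemma) auto
    have "vs ! j \<in> set vs" using less.prems 3 by simp
    then have jn: "vs ! j < n" using vs unfolding is_greedy_path_def by blast
    have jt: "vs ! j \<in> set (take (j + 1) vs)"
      unfolding in_set_conv_nth using less.prems 3 by (intro exI[of _ j]) simp
    let ?P = "\<lambda>x. x \<in> {..<n} - set (take (j + 1) vs) \<and> f {vs ! j, x} > f {vs ! (j - 1), vs ! j}"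
    have "is_arg_min (\<lambda>x. f {vs ! j, x}) ?P (vs ! (j + 1))"
      using vs less.prems 3 unfolding is_greedy_path_def by blast
    moreover have "is_arg_min (\<lambda>x. f {vs ! j, x}) ?P (ws ! (j + 1))"
      using ws less.prems 3 unfolding is_greedy_path_def j t by blast
    ultimately show ?thesis
      unfolding 3 by (rule is_arg_min_label_unique[OF f jn]) (use jt in auto)
  qed
qed

lemma greedy_path_length_le:
  assumes f: "f \<in> edge_orderings n"
    and vs: "is_greedy_path n f v vs" and ws: "is_greedy_path n f v ws"
  shows "length ws \<le> length vs"
proof (rule ccontr)
  assume "\<not> length ws \<le> length vs"
  then have l: "length vs < length ws" by simp
  have agree: "\<And>i. i < length vs \<Longrightarrow> vs ! i = ws ! i"
    using greedy_paths_agree[OF f vs ws] l by simp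
  have two: "2 \<le> length vs" using vs by (simp add: is_greedy_path_def)
  define i where "i = length vs - 1"
  have i: "1 \<le> i" "i + 1 = length vs" "i + 1 < length ws" using two l by (auto simp: i_def)
  have t: "take (i + 1) ws = vs" using agree i by (intro nth_equalityI) auto
  have "ws ! (i + 1) \<in> {..<n} - set vs \<and> f {ws ! i, ws ! (i + 1)} > f {ws ! (i - 1), ws ! i}"
    using ws i unfolding is_greedy_path_def is_arg_min_def t[symmetric] by blast
  moreover have "\<forall>x \<in> {..<n} - set vs. f {ws ! i, x} < f {ws ! (i - 1), ws ! i}"
  proof -
    have "length vs - 2 = i - 1" "length vs - 1 = i" using i by auto
    then show ?thesis using vs agree i unfolding is_greedy_path_def by simp
  qed
  ultimately show False by (meson less_asym)
qed

text \<open>The greedy path exists and is unique, so that \<open>greedy_path\<close> is well defined.\<close>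

lemma greedy_path_ex1:
  assumes f: "f \<in> edge_orderings n" and "2 \<le> n" and "v < n"
  shows "\<exists>!vs. is_greedy_path n f v vs"
proof (rule ex_ex1I)
  define Q where "Q vs \<longleftrightarrow>
     2 \<le> length vs \<and> distinct vs \<and> set vs \<subseteq> {..<n} \<and> vs ! 0 = v \<and>
     is_arg_min (\<lambda>x. f {v, x}) (\<lambda>x. x \<in> {..<n} - {v}) (vs ! 1) \<and>
     (\<forall>i. 1 \<le> i \<and> i + 1 < length vs \<longrightarrow>
        is_arg_min (\<lambda>x. f {vs ! i, x})
          (\<lambda>x. x \<in> {..<n} - set (take (i + 1) vs) \<and> f {vs ! i, x} > f {vs ! (i - 1), vs ! i})
          (vs ! (i + 1)))" for vs
  have "\<exists>x. x \<in> {..<n} - {v}"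
    using \<open>2 \<le> n\<close> by (intro exI[of _ "if v = 0 then 1 else 0"]) auto
  then obtain y where y: "is_arg_min (\<lambda>x. f {v, x}) (\<lambda>x. x \<in> {..<n} - {v}) y"
    using is_arg_min_nat_exists[of "\<lambda>x. x \<in> {..<n} - {v}"] by blast
  have "Q [v, y]"
    using y \<open>v < n\<close> unfolding Q_def is_arg_min_def by auto
  moreover have "\<forall>vs. Q vs \<longrightarrow> length vs < n + 1"
    by (metis Q_def Suc_eq_plus1 card_lessThan card_mono distinct_card finite_lessThan le_imp_less_Suc)
  ultimately obtain vs where vs: "Q vs" and max: "\<And>ws. Q ws \<Longrightarrow> length ws \<le> length vs"
    using ex_has_greatest_nat[of Q "[v, y]" length "n + 1"] by (auto simp: less_imp_le)
  define i where "i = length vs - 1"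
  have i: "1 \<le> i" "length vs = i + 1" using vs by (auto simp: Q_def i_def)
  have "f {vs ! i, x} < f {vs ! (i - 1), vs ! i}" if x: "x \<in> {..<n} - set vs" for x
  proof (rule ccontr)
    assume "\<not> ?thesis"
    moreover have "f {vs ! i, x} \<noteq> f {vs ! (i - 1), vs ! i}"
    proof
      have in_vs: "vs ! i \<in> set vs" "vs ! (i - 1) \<in> set vs" using i by auto
      have d: "vs ! (i - 1) \<noteq> vs ! i" using vs i by (auto simp: Q_def nth_eq_iff_index_eq)
      assume "f {vs ! i, x} = f {vs ! (i - 1), vs ! i}"
      moreover have "vs ! i < n" "vs ! (i - 1) < n" "x < n" "vs ! i \<noteq> x"
        using in_vs x vs by (auto simp: Q_def)
      ultimately have "{vs ! i, x} = {vs ! (i - 1), vs ! i}"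
        using edge_label_eqD[OF f] d by metis
      then show False using in_vs x by (auto simp: doubleton_eq_iff)
    qed
    ultimately have "f {vs ! i, x} > f {vs ! (i - 1), vs ! i}" by simp
    let ?P = "\<lambda>x. x \<in> {..<n} - set vs \<and> f {vs ! i, x} > f {vs ! (i - 1), vs ! i}"
    obtain z where z: "is_arg_min (\<lambda>x. f {vs ! i, x}) ?P z"
      using is_arg_min_nat_exists[of ?P x] x \<open>f {vs ! i, x} > _\<close> by blast
    have zP: "?P z" using z by (simp add: is_arg_min_def)
    have first: "(vs @ [z]) ! 0 = vs ! 0" "(vs @ [z]) ! 1 = vs ! 1"
      using i by (simp_all add: nth_append)
    have base: "2 \<le> length vs" "distinct vs" "set vs \<subseteq> {..<n}" "vs ! 0 = v"
      "is_arg_min (\<lambda>x. f {v, x}) (\<lambda>x. x \<in> {..<n} - {v}) (vs ! 1)"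
      using vs unfolding Q_def by blast+
    have "Q (vs @ [z])"
      unfolding Q_def first
    proof (intro conjI allI impI)
      fix k assume k: "1 \<le> k \<and> k + 1 < length (vs @ [z])"
      show "is_arg_min (\<lambda>x. f {(vs @ [z]) ! k, x})
          (\<lambda>x. x \<in> {..<n} - set (take (k + 1) (vs @ [z])) \<and>
            f {(vs @ [z]) ! k, x} > f {(vs @ [z]) ! (k - 1), (vs @ [z]) ! k})
          ((vs @ [z]) ! (k + 1))"
      proof (cases "k = i")
        case True
        moreover have "i - 1 < length vs" "i < length vs" using i by auto
        ultimately show ?thesis using z i by (simp add: nth_append)
      next
        case False
        then have k1: "k + 1 < length vs" using k i by simp
        then have "is_arg_min (\<lambda>x. f {vs ! k, x})
          (\<lambda>x. x \<in> {..<n} - set (take (k + 1) vs) \<and> f {vs ! k, x} > f {vs ! (k - 1), vs ! k})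
          (vs ! (k + 1))" using vs k unfolding Q_def by blast
        moreover have "k - 1 < length vs" "k < length vs" using k1 by auto
        ultimately show ?thesis using k1 by (simp add: nth_append)
      qed
    qed (use base zP in simp_all)
    then show False using max[of "vs @ [z]"] by simp
  qed
  moreover have "length vs - 1 = i" "length vs - 2 = i - 1" using i by auto
  ultimately have "is_greedy_path n f v vs"
    using vs unfolding is_greedy_path_def Q_def by simp
  then show "\<exists>vs. is_greedy_path n f v vs" ..
next
  fix vs ws assume vs: "is_greedy_path n f v vs" and ws: "is_greedy_path n f v ws"
  have "length vs = length ws"
    using greedy_path_length_le[OF f vs ws] greedy_path_length_le[OF f ws vs] by simp
  then show "vs = ws"
    using greedy_paths_agree[OF f vs ws] by (simp add: list_eq_iff_nth_eq)
qed

end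

theory Submission
  imports Defs "HOL-Combinatorics.Permutations" "HOL-Real_Asymp.Real_Asymp"
begin

text \<open>The edges from the current endpoint \<open>v\<^sub>i\<close> to the vertices not yet visited have never been
  inspected. If the labels were independent and uniform on \<open>[0,1]\<close>, the successive label increments
  \<open>G\<^sub>i\<close> along the path would therefore be independent with \<open>P(G\<^sub>i > s) = (1 - s)\<^sup>m\<close>, where \<open>m = n - 1 - i\<close>
  is the number of unvisited vertices, and the path would stop when their sum exceeds 1. As \<open>G\<^sub>i\<close> has mean about
  \<open>1/(n - i)\<close>, this happens after \<open>k\<close> steps with \<open>ln (n/(n - k)) \<approx> 1\<close>, that is \<open>k \<approx> (1 - 1/e) n\<close>.
  Exponential moments of order \<open>p\<close>, fixed while \<open>n \<rightarrow> \<infinity>\<close> and then sent to infinity,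
  bound both tails. To stay in finite probability spaces the labels are taken uniform on \<open>{1..M}\<close> with \<open>M\<close> large;
  they are injective with probability at least \<open>1/2\<close>, and then induce a uniform edge ordering.\<close>

section \<open>The greedy path as a recursive walk\<close>

definition pairs :: "'a set \<Rightarrow> 'a set set" where
  "pairs W = {e. e \<subseteq> W \<and> card e = 2}"

definition greedy_next :: "('a set \<Rightarrow> nat) \<Rightarrow> 'a set \<Rightarrow> 'a \<Rightarrow> nat \<Rightarrow> 'a" where
  "greedy_next f U v l = arg_min (\<lambda>x. f {v, x}) (\<lambda>x. x \<in> U \<and> l < f {v, x})"

text \<open>The future of the path depends on its past only through the unvisited vertices
  \<open>U\<close>, the endpoint \<open>v\<close> and the last label \<open>l\<close>. Path length
  is encoded by the events that \<open>k\<close> further steps are possible from such a state, which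
  suits tail bounds by induction on \<open>k\<close>. Starting with \<open>l = 0\<close>, below all
  labels, subsumes the rule for the first edge.\<close>

primrec greedy_walk :: "('a set \<Rightarrow> nat) \<Rightarrow> nat \<Rightarrow> 'a set \<Rightarrow> 'a \<Rightarrow> nat \<Rightarrow> bool" where
  "greedy_walk f 0 U v l \<longleftrightarrow> True"
| "greedy_walk f (Suc k) U v l \<longleftrightarrow> (\<exists>x\<in>U. l < f {v, x}) \<and>
     (let x = greedy_next f U v l in greedy_walk f k (U - {x}) x (f {v, x}))"

lemma greedy_next_is_arg_min:
  assumes "\<exists>x\<in>U. l < f {v, x}"
  shows "is_arg_min (\<lambda>x. f {v, x}) (\<lambda>x. x \<in> U \<and> l < f {v, x}) (greedy_next f U v l)"
proof -
  from assms obtain x where "x \<in> U \<and> l < f {v, x}" by blast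
  from is_arg_min_nat_exists[of "\<lambda>x. x \<in> U \<and> l < f {v, x}", OF this]
  show ?thesis unfolding greedy_next_def arg_min_def by (rule someI_ex)
qed

lemma greedy_nextD:
  assumes "\<exists>x\<in>U. l < f {v, x}"
  shows "greedy_next f U v l \<in> U" "l < f {v, greedy_next f U v l}"
    and "\<And>y. y \<in> U \<Longrightarrow> l < f {v, y} \<Longrightarrow> f {v, greedy_next f U v l} \<le> f {v, y}"
  using greedy_next_is_arg_min[of U l f v, OF assms]
  unfolding is_arg_min_def by (auto simp: not_less)

lemma greedy_next_strict_mono:
  assumes h: "strict_mono_on A h" and "l \<in> A"
    and g: "\<And>x. x \<in> U \<Longrightarrow> f {v, x} \<in> A \<and> g {v, x} = h (f {v, x})"
  shows "greedy_next g U v (h l) = greedy_next f U v l"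
proof -
  have less: "h a < h b \<longleftrightarrow> a < b" if "a \<in> A" "b \<in> A" for a b
    using h that by (rule strict_mono_on_less)
  have "is_arg_min (\<lambda>x. g {v, x}) (\<lambda>x. x \<in> U \<and> h l < g {v, x}) =
      is_arg_min (\<lambda>x. f {v, x}) (\<lambda>x. x \<in> U \<and> l < f {v, x})"
    unfolding is_arg_min_def fun_eq_iff using g less \<open>l \<in> A\<close> by metis
  then show ?thesis unfolding greedy_next_def arg_min_def by simp
qed

text \<open>The walk uses labels only through comparisons, so an increasing relabelling leaves it
  unchanged. This later connects edge orderings with labels in \<open>{1..M}\<close>, where the
  relabelling is increasing only on an initial segment; hence the set \<open>A\<close>.\<close>

lemma greedy_walk_strict_mono:
  assumes h: "strict_mono_on A h"
  shows "l \<in> A \<Longrightarrow> v \<notin> U \<Longrightarrow> (\<And>e. e \<in> pairs (insert v U) \<Longrightarrow> f e \<in> A \<and> g e = h (f e)) \<Longrightarrow>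
    greedy_walk g k U v (h l) \<longleftrightarrow> greedy_walk f k U v l"
proof (induction k arbitrary: U v l)
  case (Suc k)
  have fg: "f {v, x} \<in> A \<and> g {v, x} = h (f {v, x})" if "x \<in> U" for x
    using Suc.prems(2) that by (intro Suc.prems(3)) (auto simp: pairs_def card_2_iff)
  have ex: "(\<exists>x\<in>U. h l < g {v, x}) \<longleftrightarrow> (\<exists>x\<in>U. l < f {v, x})"
    using fg strict_mono_on_less[OF h \<open>l \<in> A\<close>] by metis
  have nxt: "greedy_next g U v (h l) = greedy_next f U v l"
    using greedy_next_strict_mono[OF h \<open>l \<in> A\<close>] fg by metis
  show ?case
  proof (cases "\<exists>x\<in>U. l < f {v, x}")
    case True
    define x where "x = greedy_next f U v l"
    have x: "x \<in> U" using greedy_nextD(1)[of U l f v, OF True] by (simp add: x_def)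
    have "greedy_walk g k (U - {x}) x (h (f {v, x})) \<longleftrightarrow> greedy_walk f k (U - {x}) x (f {v, x})"
    proof (rule Suc.IH)
      show "f e \<in> A \<and> g e = h (f e)" if "e \<in> pairs (insert x (U - {x}))" for e
        using that x by (intro Suc.prems(3)) (auto simp: pairs_def)
    qed (use fg x in auto)
    then show ?thesis using True ex nxt fg x by (simp add: x_def Let_def)
  next
    case False
    then show ?thesis using ex by simp
  qed
qed simp

text \<open>The case of the identity relabelling. It allows the labels at vertices already left
  behind to be discarded.\<close>

lemma greedy_walk_cong:
  assumes "v \<notin> U" "\<And>e. e \<in> pairs (insert v U) \<Longrightarrow> g e = f e"
  shows "greedy_walk g k U v l \<longleftrightarrow> greedy_walk f k U v l"
  using greedy_walk_strict_mono[of UNIV id l v U f g k] assms by (simp add: strict_mono_on_def)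

text \<open>Induction on \<open>k\<close>, for all positions \<open>i\<close> at once:
  \<open>U i\<close>, \<open>vs ! i\<close> and \<open>l i\<close> form the state of the walk at the
  \<open>i\<close>-th vertex of the path.\<close>

lemma greedy_walk_greedy_path:
  assumes f: "f \<in> edge_orderings n" and vs: "is_greedy_path n f v vs"
  shows "greedy_walk f k ({..<n} - {v}) v 0 \<longleftrightarrow> k \<le> path_length vs"
proof -
  define U where "U i = {..<n} - set (take (i + 1) vs)" for i
  define l where "l i = (if i = 0 then 0 else f {vs ! (i - 1), vs ! i})" for i
  have vsD: "2 \<le> length vs" "distinct vs" "set vs \<subseteq> {..<n}" "vs ! 0 = v"
     "is_arg_min (\<lambda>x. f {v, x}) (\<lambda>x. x \<in> {..<n} - {v}) (vs ! 1)"
     "\<And>i. 1 \<le> i \<Longrightarrow> i + 1 < length vs \<Longrightarrow>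
        is_arg_min (\<lambda>x. f {vs ! i, x})
          (\<lambda>x. x \<in> {..<n} - set (take (i + 1) vs) \<and> f {vs ! i, x} > f {vs ! (i - 1), vs ! i})
          (vs ! (i + 1))"
     "\<And>x. x \<in> {..<n} - set vs \<Longrightarrow>
        f {vs ! (length vs - 1), x} < f {vs ! (length vs - 2), vs ! (length vs - 1)}"
    using vs unfolding is_greedy_path_def by blast+
  have U0: "U 0 = {..<n} - {v}" unfolding U_def using vsD(1,4) by (cases vs) auto
  \<comment> \<open>Labels start at 1, so the initial threshold 0 excludes no edge and the first
    edge becomes an instance of the general step.\<close>
  have pos: "0 < f {a, b}" if "a < n" "b < n" "a \<noteq> b" for a b
    using f edge_in_complete_edges[OF that] unfolding edge_orderings_def bij_betw_def by fastforce
  have step: "is_arg_min (\<lambda>x. f {vs ! i, x}) (\<lambda>x. x \<in> U i \<and> l i < f {vs ! i, x}) (vs ! (i + 1))"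
    if "i + 1 < length vs" for i
  proof (cases "i = 0")
    case True
    have vn: "v < n" using vsD(1,3,4) by (metis lessThan_iff less_le_trans nth_mem pos2 subsetD)
    have "(\<lambda>x. x \<in> U 0 \<and> l 0 < f {v, x}) = (\<lambda>x. x \<in> {..<n} - {v})"
      using pos[OF vn] unfolding U0 by (auto simp: l_def fun_eq_iff)
    then show ?thesis using vsD(4,5) True by simp
  next
    case False
    then show ?thesis using vsD(6)[of i] that by (simp add: U_def l_def)
  qed
  have nxt: "greedy_next f (U i) (vs ! i) (l i) = vs ! (i + 1)"
    and U_Suc: "U i - {vs ! (i + 1)} = U (i + 1)"
    and ex: "\<exists>x\<in>U i. l i < f {vs ! i, x}" if i: "i + 1 < length vs" for i
  proof -
    show ex: "\<exists>x\<in>U i. l i < f {vs ! i, x}" using step[OF i] by (auto simp: is_arg_min_def)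
    have "vs ! i < n" using vsD(3) i by (metis add_lessD1 lessThan_iff nth_mem subsetD)
    moreover have "vs ! i \<in> set (take (i + 1) vs)" using i
      unfolding in_set_conv_nth by (intro exI[of _ i]) simp
    ultimately show "greedy_next f (U i) (vs ! i) (l i) = vs ! (i + 1)"
      using is_arg_min_label_unique[OF f _ greedy_next_is_arg_min[of "U i" "l i" f "vs ! i", OF ex] step[OF i]]
      by (auto simp: U_def)
    show "U i - {vs ! (i + 1)} = U (i + 1)"
      using i by (auto simp: U_def take_Suc_conv_app_nth)
  qed
  have "greedy_walk f k (U i) (vs ! i) (l i) \<longleftrightarrow> i + k \<le> path_length vs" if "i < length vs" for i
    using that
  proof (induction k arbitrary: i)
    case 0
    then show ?case by (simp add: path_length_def)
  next
    case (Suc k)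
    show ?case
    proof (cases "i + 1 < length vs")
      case True
      then show ?thesis using Suc.IH[of "i + 1"] nxt[OF True] ex[OF True] U_Suc[OF True]
        by (simp add: Let_def l_def)
    next
      case False
      then have i: "i = length vs - 1" "i \<noteq> 0" "i - 1 = length vs - 2" using Suc.prems vsD(1) by auto
      \<comment> \<open>Maximality of the path: no edge at its last vertex is admissible, so both
        sides of the claim are false.\<close>
      have "f {vs ! i, x} < l i" if "x \<in> U i" for x
        using vsD(7)[of x] that i by (simp add: l_def U_def)
      then have "\<not> (\<exists>x\<in>U i. l i < f {vs ! i, x})" by (meson less_asym)
      then show ?thesis using i by (simp add: path_length_def)
    qed
  qed
  moreover have "0 < length vs" "l 0 = 0" using vsD(1) by (auto simp: l_def)
  ultimately show ?thesis using vsD(4) U0 by (metis add_0)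
qed

section \<open>Independent uniform labels\<close>

text \<open>The default value \<open>undefined\<close> makes the labellings extensional, in line
  with \<open>edge_orderings\<close>, so that the distribution is uniform on
  \<open>S \<rightarrow>\<^sub>E {1..M}\<close>.\<close>

definition iid_labels :: "nat \<Rightarrow> 'e set \<Rightarrow> ('e \<Rightarrow> nat) pmf" where
  "iid_labels M S = Pi_pmf S undefined (\<lambda>_. pmf_of_set {1..M})"

lemma set_pmf_iid_labels:
  assumes "finite S" "M \<ge> 1"
  shows "set_pmf (iid_labels M S) = S \<rightarrow>\<^sub>E {1..M}"
proof -
  have "set_pmf (iid_labels M S) = PiE_dflt S undefined (\<lambda>_. {1..M})"
    using assms by (simp add: iid_labels_def set_Pi_pmf o_def)
  then show ?thesis by (auto simp: PiE_dflt_def PiE_def extensional_def)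
qed

lemma iid_labels_eq_pmf_of_set:
  assumes "finite S" "M \<ge> 1"
  shows "iid_labels M S = pmf_of_set (S \<rightarrow>\<^sub>E {1..M})"
proof -
  have "iid_labels M S = pmf_of_set (PiE_dflt S undefined (\<lambda>_. {1..M}))"
    unfolding iid_labels_def using assms by (intro Pi_pmf_of_set) auto
  also have "PiE_dflt S undefined (\<lambda>_. {1..M}) = S \<rightarrow>\<^sub>E {1..M}"
    by (auto simp: PiE_dflt_def PiE_def extensional_def)
  finally show ?thesis .
qed

lemma integrable_iid_labels:
  fixes F :: "('e \<Rightarrow> nat) \<Rightarrow> real"
  assumes "finite S" "M \<ge> 1"
  shows "integrable (measure_pmf (iid_labels M S)) F"
  using assms by (intro integrable_measure_pmf_finite) (auto simp: set_pmf_iid_labels intro: finite_PiE)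

lemma expectation_iid_labels_mono:
  fixes F G :: "('e \<Rightarrow> nat) \<Rightarrow> real"
  assumes "finite S" "M \<ge> 1" "\<And>g. g \<in> S \<rightarrow>\<^sub>E {1..M} \<Longrightarrow> F g \<le> G g"
  shows "measure_pmf.expectation (iid_labels M S) F \<le> measure_pmf.expectation (iid_labels M S) G"
  using assms by (intro integral_mono_AE integrable_iid_labels)
    (auto simp: AE_measure_pmf_iff set_pmf_iid_labels)

lemma prob_iid_labels_Pi:
  assumes "finite S" "M \<ge> 1"
  shows "measure_pmf.prob (iid_labels M S) (Pi S B) = (\<Prod>e\<in>S. real (card ({1..M} \<inter> B e)) / real M)"
  using assms unfolding iid_labels_def
  by (subst measure_Pi_pmf_Pi) (auto simp: measure_pmf_of_set)

text \<open>Fubini: the labels on a disjoint union are an independent pair, so the labels on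
  \<open>S\<close> can be fixed first and averaged over afterwards.\<close>

lemma prob_iid_labels_Un:
  assumes S: "finite S" "finite T" "S \<inter> T = {}"
  shows "measure_pmf.prob (iid_labels M (S \<union> T)) {f. Q f} =
    measure_pmf.expectation (iid_labels M S)
      (\<lambda>g. measure_pmf.prob (iid_labels M T) {h. Q (\<lambda>e. if e \<in> S then g e else h e)})"
    (is "_ = measure_pmf.expectation _ ?P")
proof -
  let ?A = "iid_labels M S" and ?B = "iid_labels M T"
  let ?m = "\<lambda>g h e. if e \<in> S then g e else h e"
  have "emeasure (iid_labels M (S \<union> T)) {f. Q f} =
      emeasure (map_pmf (\<lambda>(g, h). ?m g h) (pair_pmf ?A ?B)) {f. Q f}"
    unfolding iid_labels_def by (subst Pi_pmf_union[OF S]) simp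
  also have "\<dots> = emeasure (pair_pmf ?A ?B) {(g, h). Q (?m g h)}"
    by (simp add: vimage_def case_prod_unfold)
  also have "\<dots> = (\<integral>\<^sup>+ g. \<integral>\<^sup>+ h. indicator {(g, h). Q (?m g h)} (g, h) \<partial>?B \<partial>?A)"
    by (simp flip: nn_integral_pair_pmf' add: nn_integral_indicator)
  also have "\<dots> = (\<integral>\<^sup>+ g. emeasure ?B {h. Q (?m g h)} \<partial>?A)"
    proof (rule nn_integral_cong)
    fix g
    have "(\<lambda>h. indicator {(g, h). Q (?m g h)} (g, h)) = (indicator {h. Q (?m g h)} :: _ \<Rightarrow> ennreal)"
      by (auto simp: indicator_def)
    then show "(\<integral>\<^sup>+ h. indicator {(g, h). Q (?m g h)} (g, h) \<partial>?B) = emeasure ?B {h. Q (?m g h)}"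
      by simp
  qed
  also have "\<dots> = (\<integral>\<^sup>+ g. ennreal (?P g) \<partial>?A)"
    by (simp add: measure_pmf.emeasure_eq_measure)
  also have "\<dots> = ennreal (measure_pmf.expectation ?A ?P)"
    by (intro nn_integral_eq_integral measure_pmf.integrable_const_bound[where B=1]) auto
  finally show ?thesis by (simp add: measure_pmf.emeasure_eq_measure)
qed

section \<open>Exponential moments of one label increment\<close>

text \<open>\<open>T g\<close> is the smallest label above \<open>l\<close>. With
  \<open>m = card S\<close>, the scaled increment is nearly exponential of rate \<open>m\<close>,
  for which the moment of order \<open>-q\<close> is \<open>m / (m + q)\<close>. Taking order
  \<open>-(q + 2)\<close> on the left absorbs all discretization errors, so the clean value remains
  on the right. The value 0 stands for a walk that cannot continue.\<close>

lemma expectation_exp_minus_next_label: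
  fixes T :: "('e \<Rightarrow> nat) \<Rightarrow> nat" and q :: real
  assumes S: "finite S" and M: "M \<ge> 1" "(card S)\<^sup>2 \<le> M" and "l \<le> M" and q: "q > 0"
    and T: "\<And>g. \<exists>e\<in>S. l < g e \<Longrightarrow> \<exists>e\<in>S. T g = g e \<and> l < g e \<and> (\<forall>e'\<in>S. l < g e' \<longrightarrow> g e \<le> g e')"
  shows "measure_pmf.expectation (iid_labels M S)
      (\<lambda>g. if \<exists>e\<in>S. l < g e then exp (- (q + 2) * (real (T g) - real l) / real M) else 0)
    \<le> card S / (card S + q)"
proof -
  define m where "m = card S"
  define w where "w s = exp (- (q + 2) * real (s + 1) / real M)" for s :: nat
  \<comment> \<open>The edge \<open>e\<close> carries the label \<open>l + s + 1\<close> and the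
    other edges avoid the gap below it. With ties several of these events hold together, so the sum
    over them is only an upper bound.\<close>
  define A where "A e s = Pi S (\<lambda>e'. if e' = e then {l + s + 1} else - {l<..l + s})" for e s
  have PA: "measure_pmf.prob (iid_labels M S) (A e s) \<le> (1 / M) * exp (- (m - 1) * s / M)"
    if e: "e \<in> S" and s: "s < M - l" for e s
  proof -
    have c: "card ({1..M} - {l<..l + s}) = M - s"
      using s by (subst card_Diff_subset) auto
    have "m \<ge> 1" using S e by (auto simp: m_def Suc_le_eq card_gt_0_iff)
    have "measure_pmf.prob (iid_labels M S) (A e s) =
       (\<Prod>e'\<in>S. real (card ({1..M} \<inter> (if e' = e then {l + s + 1} else - {l<..l + s}))) / real M)"
      unfolding A_def by (rule prob_iid_labels_Pi[OF S M(1)])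
    also have "\<dots> = real (card ({1..M} \<inter> {l + s + 1})) / M *
        (\<Prod>e'\<in>S-{e}. real (card ({1..M} \<inter> - {l<..l + s})) / real M)"
      using S e by (subst prod.remove[OF S e]) (auto intro!: prod.cong)
    also have "{1..M} \<inter> {l + s + 1} = {l + s + 1}" using s by auto
    also have "(\<Prod>e'\<in>S-{e}. real (card ({1..M} \<inter> - {l<..l + s})) / real M) = (1 - s / M) ^ (m - 1)"
      using S e c s M by (simp add: m_def Diff_eq[symmetric] of_nat_diff diff_divide_distrib)
    also have "real (card {l + s + 1}) / M * (1 - s / M) ^ (m - 1)
        \<le> 1 / M * exp (- (s / M)) ^ (m - 1)"
      using s M exp_ge_add_one_self[of "- (s / M)"]
      by (intro mult_mono power_mono) (auto simp: field_simps)
    also have "exp (- (s / M)) ^ (m - 1) = exp (- (m - 1) * s / M)"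
      using \<open>m \<ge> 1\<close> by (simp add: exp_of_nat_mult[symmetric] of_nat_diff)
        (metis left_diff_distrib minus_diff_eq minus_divide_left mult_minus_left)
    finally show ?thesis .
  qed
  have "measure_pmf.expectation (iid_labels M S)
      (\<lambda>g. if \<exists>e\<in>S. l < g e then exp (- (q + 2) * (real (T g) - real l) / real M) else 0)
    \<le> measure_pmf.expectation (iid_labels M S)
      (\<lambda>g. \<Sum>e\<in>S. \<Sum>s<M-l. w s * indicator (A e s) g)"
  proof (rule expectation_iid_labels_mono[OF S M(1)])
    fix g assume g: "g \<in> S \<rightarrow>\<^sub>E {1..M}"
    have nn: "0 \<le> w s * indicator (A e s) g" for e s by (simp add: w_def)
    show "(if \<exists>e\<in>S. l < g e then exp (- (q + 2) * (real (T g) - real l) / real M) else 0)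
      \<le> (\<Sum>e\<in>S. \<Sum>s<M-l. w s * indicator (A e s) g)"
    proof (cases "\<exists>e\<in>S. l < g e")
      case True
      then obtain e where e: "e \<in> S" "T g = g e" "l < g e" "\<forall>e'\<in>S. l < g e' \<longrightarrow> g e \<le> g e'"
        using T by blast
      define s where "s = g e - l - 1"
      have ge: "g e = l + s + 1" "s < M - l" using e g by (force simp: s_def PiE_def Pi_def)+
      have "g \<in> A e s" unfolding A_def using e ge by force
      then have "exp (- (q + 2) * (real (T g) - real l) / real M) = w s * indicator (A e s) g"
        using e ge by (simp add: w_def)
      also have "\<dots> \<le> (\<Sum>s<M-l. w s * indicator (A e s) g)"
        using ge nn by (intro member_le_sum) auto
      also have "\<dots> \<le> (\<Sum>e\<in>S. \<Sum>s<M-l. w s * indicator (A e s) g)"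
        using e S nn by (intro member_le_sum[of e S "\<lambda>e. \<Sum>s<M-l. w s * indicator (A e s) g"] sum_nonneg) auto
      finally show ?thesis using True by simp
    next
      case False
      then show ?thesis by (auto intro!: sum_nonneg simp: w_def)
    qed
  qed
  also have "\<dots> = (\<Sum>e\<in>S. \<Sum>s<M-l. w s * measure_pmf.prob (iid_labels M S) (A e s))"
  proof -
    have "measure_pmf.expectation (iid_labels M S) (\<lambda>g. \<Sum>e\<in>S. \<Sum>s<M-l. w s * indicator (A e s) g) =
        (\<Sum>e\<in>S. measure_pmf.expectation (iid_labels M S) (\<lambda>g. \<Sum>s<M-l. w s * indicator (A e s) g))"
      by (intro Bochner_Integration.integral_sum integrable_iid_labels[OF S M(1)])
    also have "\<dots> = (\<Sum>e\<in>S. \<Sum>s<M-l. measure_pmf.expectation (iid_labels M S) (\<lambda>g. w s * indicator (A e s) g))"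
      by (intro sum.cong refl Bochner_Integration.integral_sum integrable_iid_labels[OF S M(1)])
    finally show ?thesis by simp
  qed
  also have "\<dots> \<le> (\<Sum>e\<in>S. \<Sum>s<M-l. w s * ((1 / M) * exp (- (m - 1) * s / M)))"
    using PA by (intro sum_mono mult_left_mono) (auto simp: w_def)
  also have "\<dots> = m / M * (\<Sum>s<M-l. exp (- (q + 2) / M) * exp (- (m + q + 1) / M) ^ s)"
    by (simp add: m_def[symmetric] w_def sum_distrib_left exp_of_nat_mult[symmetric] exp_add[symmetric] mult_exp_exp)
       (auto intro!: sum.cong simp: field_simps)
  also have "\<dots> \<le> m / (m + q)"
  proof (cases "m = 0")
    case False
    define y where "y = real (m - 1) / M"
    define r where "r = exp (- (m + q + 1) / M)"
    have r: "0 < r" "r < 1" using M q by (auto simp: r_def divide_neg_pos)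
    have "y \<ge> 0" by (simp add: y_def)
    have "exp (-y) \<le> 1 / (1 + y)"
      using exp_ge_add_one_self[of y] \<open>y \<ge> 0\<close> by (simp add: exp_minus field_simps)
    also have "\<dots> \<le> 1 - y + y\<^sup>2"
      using \<open>y \<ge> 0\<close> by (simp add: field_simps power2_eq_square)
    finally have ey: "exp (-y) \<le> 1 - y + y\<^sup>2" .
    have "M * y\<^sup>2 \<le> 1"
    proof -
      have "(real (m - 1))\<^sup>2 \<le> (real m)\<^sup>2" by (intro power_mono) auto
      also have "\<dots> \<le> M" using M(2) by (metis m_def of_nat_le_iff of_nat_power)
      finally show ?thesis using M by (simp add: y_def power2_eq_square field_simps)
    qed
    have My: "M * y = real m - 1" using False M by (simp add: y_def of_nat_diff)
    have "(\<Sum>s<M-l. exp (- (q + 2) / M) * r ^ s) = exp (- (q + 2) / M) * ((1 - r ^ (M - l)) / (1 - r))"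
      using r by (simp add: sum_distrib_left[symmetric] sum_gp_strict)
    also have "\<dots> \<le> exp (- (q + 2) / M) * (1 / (1 - r))"
      using r by (intro mult_left_mono divide_right_mono) auto
    also have "\<dots> = 1 / (exp ((q + 2) / M) - exp (-y))"
    proof -
      have "r = exp (- (q + 2) / M) * exp (- y)"
        using False by (simp add: r_def y_def exp_add[symmetric] of_nat_diff field_simps
            add_divide_distrib[symmetric] diff_divide_distrib[symmetric])
      moreover have "exp (- (q + 2) / M) * exp ((q + 2) / M) = 1"
        unfolding exp_add[symmetric] by (simp add: add_divide_distrib[symmetric])
      ultimately have "1 - r = exp (- (q + 2) / M) * (exp ((q + 2) / M) - exp (-y))"
        by (simp only: right_diff_distrib)
      then show ?thesis by simp
    qed
    also have "\<dots> \<le> 1 / ((m + q) / M)"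
    proof (rule divide_left_mono)
      \<comment> \<open>Here the 2 in the exponent is spent: one unit makes up for
        \<open>m - 1\<close> in place of \<open>m\<close>, as only the other edges have to avoid the
        gap, and one pays for the quadratic error \<open>y\<^sup>2\<close>, which is at most
        \<open>1 / M\<close>.\<close>
      have "(m + q) / M = ((q + 2) + M * y - 1) / M" using My by (simp add: algebra_simps)
      also have "\<dots> = (q + 2) / M + y - 1 / M" using M by (simp add: field_simps)
      also have "\<dots> \<le> (q + 2) / M + y - y\<^sup>2" using \<open>M * y\<^sup>2 \<le> 1\<close> M by (simp add: field_simps)
      also have "\<dots> \<le> exp ((q + 2) / M) - exp (-y)"
        using ey exp_ge_add_one_self[of "(q + 2) / M"] by linarith
      finally show le: "(m + q) / M \<le> exp ((q + 2) / M) - exp (-y)" .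
      have "0 < (m + q) / M" using M q by simp
      with le show "0 < (exp ((q + 2) / M) - exp (-y)) * ((m + q) / M)"
        by (intro mult_pos_pos) linarith+
    qed simp
    finally have "m / M * (\<Sum>s<M-l. exp (- (q + 2) / M) * r ^ s) \<le> m / M * (1 / ((m + q) / M))"
      by (intro mult_left_mono) auto
    then show ?thesis using M by (simp add: r_def)
  qed simp
  finally show ?thesis by (simp add: m_def)
qed

text \<open>The moment of positive order \<open>q\<close>, which is \<open>m / (m - q)\<close> for
  an exponential variable of rate \<open>m = card S\<close>; lowering \<open>m\<close> by one covers
  the discretization. If no label exceeds \<open>l\<close>, the increment is taken to be
  \<open>M - l\<close>, so that a walk that stops has used up the whole range of labels.\<close>

lemma expectation_exp_next_label:
  fixes T :: "('e \<Rightarrow> nat) \<Rightarrow> nat" and q :: real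
  assumes S: "finite S" and q: "q > 0" and M: "(card S)\<^sup>2 + q \<le> M" and "l \<le> M"
    and m: "q + 1 < card S"
    and T: "\<And>g. \<exists>e\<in>S. l < g e \<Longrightarrow> \<exists>e\<in>S. T g = g e \<and> l < g e \<and> (\<forall>e'\<in>S. l < g e' \<longrightarrow> g e \<le> g e')"
  shows "measure_pmf.expectation (iid_labels M S)
      (\<lambda>g. exp (q * (real (if \<exists>e\<in>S. l < g e then T g else M) - real l) / real M))
    \<le> (card S - 1) / (card S - 1 - q)"
proof -
  define m where "m = card S"
  have "0 < real M" using M q zero_le_power2[of "real (card S)"] by linarith
  then have M1: "M \<ge> 1" by simp
  define A where "A s = Pi S (\<lambda>_::'e. - {l<..l + s})" for s
  define a where "a = exp (q / M)"
  have a: "a > 1" using q M1 by (simp add: a_def)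
  have PA: "measure_pmf.prob (iid_labels M S) (A s) \<le> exp (- (m / M)) ^ s"
    if s: "s < M - l" for s
  proof -
    have c: "card ({1..M} - {l<..l + s}) = M - s"
      using s by (subst card_Diff_subset) auto
    have "measure_pmf.prob (iid_labels M S) (A s) =
       (\<Prod>e'\<in>S. real (card ({1..M} \<inter> - {l<..l + s})) / real M)"
      unfolding A_def by (rule prob_iid_labels_Pi[OF S M1])
    also have "\<dots> = (1 - s / M) ^ m"
      using S c s M1 by (simp add: m_def Diff_eq[symmetric] of_nat_diff diff_divide_distrib)
    also have "\<dots> \<le> exp (- (s / M)) ^ m"
      using s M1 exp_ge_add_one_self[of "- (s / M)"]
      by (intro power_mono) (auto simp: field_simps)
    also have "\<dots> = exp (- (m / M)) ^ s"
      by (simp add: exp_of_nat_mult[symmetric])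
    finally show ?thesis .
  qed
  have "measure_pmf.expectation (iid_labels M S)
      (\<lambda>g. exp (q * (real (if \<exists>e\<in>S. l < g e then T g else M) - real l) / real M))
    \<le> measure_pmf.expectation (iid_labels M S)
      (\<lambda>g. 1 + (a - 1) * (\<Sum>s<M-l. a ^ s * indicator (A s) g))"
  proof (rule expectation_iid_labels_mono[OF S M1])
    fix g assume g: "g \<in> S \<rightarrow>\<^sub>E {1..M}"
    define G where "G = (if \<exists>e\<in>S. l < g e then T g else M) - l"
    have G: "(if \<exists>e\<in>S. l < g e then T g else M) = l + G \<and> G \<le> M - l \<and> (\<forall>s<G. g \<in> A s)"
    proof (cases "\<exists>e\<in>S. l < g e")
      case True
      then obtain e where e: "e \<in> S" "T g = g e" "l < g e" "\<forall>e'\<in>S. l < g e' \<longrightarrow> g e \<le> g e'"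
        using T by blast
      have "g e \<le> M" using e g by auto
      then show ?thesis using True e by (force simp: G_def A_def)
    next
      case False
      then show ?thesis using \<open>l \<le> M\<close> by (force simp: G_def A_def)
    qed
    then have "exp (q * (real (if \<exists>e\<in>S. l < g e then T g else M) - real l) / real M) = exp (q * real G / M)"
      by simp
    also have "\<dots> = a ^ G"
      by (simp add: a_def exp_of_nat_mult[symmetric] mult.commute)
    \<comment> \<open>Summation by parts: the moment is expressed through the tail events
      \<open>A s\<close>, which hold for all \<open>s < G\<close>, so upper bounds on their
      probabilities suffice.\<close>
    also have "\<dots> = 1 + (a - 1) * (\<Sum>s<G. a ^ s)"
      using power_diff_1_eq[of a G] by (simp add: lessThan_def)
    also have "(\<Sum>s<G. a ^ s) = (\<Sum>s<G. a ^ s * indicator (A s) g)"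
      using G by (intro sum.cong) auto
    also have "\<dots> \<le> (\<Sum>s<M-l. a ^ s * indicator (A s) g)"
      using G a by (intro sum_mono2) auto
    finally show "exp (q * (real (if \<exists>e\<in>S. l < g e then T g else M) - real l) / real M)
      \<le> 1 + (a - 1) * (\<Sum>s<M-l. a ^ s * indicator (A s) g)" using a by simp
  qed
  also have "\<dots> = 1 + (a - 1) * (\<Sum>s<M-l. a ^ s * measure_pmf.prob (iid_labels M S) (A s))"
  proof -
    have "measure_pmf.expectation (iid_labels M S) (\<lambda>g. \<Sum>s<M-l. a ^ s * indicator (A s) g) =
        (\<Sum>s<M-l. measure_pmf.expectation (iid_labels M S) (\<lambda>g. a ^ s * indicator (A s) g))"
      by (intro Bochner_Integration.integral_sum integrable_iid_labels[OF S M1])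
    also have "\<dots> = (\<Sum>s<M-l. a ^ s * measure_pmf.prob (iid_labels M S) (A s))" by simp
    finally show ?thesis
      by (subst Bochner_Integration.integral_add)
        (auto intro: integrable_iid_labels[OF S M1] simp del: sum_mult_indicator)
  qed
  also have "\<dots> \<le> 1 + (a - 1) * (\<Sum>s<M-l. a ^ s * exp (- (m / M)) ^ s)"
    using PA a by (intro add_left_mono mult_left_mono sum_mono) auto
  also have "\<dots> = 1 + (a - 1) * (\<Sum>s<M-l. exp (- ((m - q) / M)) ^ s)"
    by (simp add: a_def power_mult_distrib[symmetric] exp_add[symmetric] diff_divide_distrib)
  also have "\<dots> \<le> (m - 1) / (m - 1 - q)"
  proof -
    define y where "y = (m - q) / M"
    define r where "r = exp (-y)"
    have "y > 0" using m M1 by (simp add: y_def m_def)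
    then have r: "0 < r" "r < 1" by (auto simp: r_def)
    have "exp (-y) \<le> 1 / (1 + y)"
      using exp_ge_add_one_self[of y] \<open>y > 0\<close> by (simp add: exp_minus field_simps)
    then have r1: "1 - r \<ge> y / (1 + y)" using \<open>y > 0\<close> by (simp add: r_def field_simps)
    have qM: "q < M" proof -
      have "0 < (real (card S))\<^sup>2" using m q by (intro zero_less_power) linarith
      then show ?thesis using M by (simp only: of_nat_power)
    qed
    have "1 - q / M \<le> exp (- (q / M))" using exp_ge_add_one_self[of "- (q / M)"] by simp
    then have "a \<le> 1 / (1 - q / M)" using qM M1 unfolding a_def exp_minus by (simp add: field_simps)
    then have a1: "a - 1 \<le> q / (M - q)" using qM M1 by (simp add: field_simps)
    have "(\<Sum>s<M-l. r ^ s) = (1 - r ^ (M - l)) / (1 - r)"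
      using r by (simp add: sum_gp_strict)
    also have "\<dots> \<le> 1 / (1 - r)"
      using r by (intro divide_right_mono) auto
    also have "\<dots> \<le> 1 / (y / (1 + y))"
      using r1 r \<open>y > 0\<close> by (intro divide_left_mono) auto
    also have "\<dots> = (M + m - q) / (m - q)"
      using M1 \<open>y > 0\<close> m unfolding y_def by (simp add: field_simps m_def)
    finally have "(a - 1) * (\<Sum>s<M-l. r ^ s) \<le> q / (M - q) * ((M + m - q) / (m - q))"
      using a1 a r by (intro mult_mono) (auto intro!: sum_nonneg)
    also have "\<dots> = q / (m - q) * (1 + m / (M - q))"
      using qM by (simp add: field_simps)
    \<comment> \<open>The hypothesis \<open>(card S)\<^sup>2 + q \<le> M\<close> makes the
      discretization error at most \<open>1 / m\<close>, small enough to be hidden by passing from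
      \<open>m\<close> to \<open>m - 1\<close>.\<close>
    also have "\<dots> \<le> q / (m - q) * (1 + 1 / m)"
    proof -
      have "real m * m \<le> M - q" using M by (simp add: m_def power2_eq_square)
      then have "m / (M - q) \<le> 1 / m" using qM m q by (simp add: field_simps m_def)
      then show ?thesis using q m by (intro mult_left_mono) (auto simp: m_def)
    qed
    also have "\<dots> \<le> q / (m - 1 - q)"
    proof -
      have "(real m + 1) * (m - 1 - q) \<le> m * (m - q)" using q m by (simp add: m_def algebra_simps)
      then have "(real m + 1) / (m * (m - q)) \<le> 1 / (m - 1 - q)" using q m by (simp add: m_def field_simps)
      then have "q * ((real m + 1) / (m * (m - q))) \<le> q * (1 / (m - 1 - q))" using q by (intro mult_left_mono) auto
      then show ?thesis using q m by (simp add: m_def field_simps)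
    qed
    finally show ?thesis using m by (simp add: r_def y_def m_def field_simps)
  qed
  finally show ?thesis using m q by (simp add: m_def)
qed

section \<open>Separating the edges at the endpoint from the rest\<close>

definition star :: "'a \<Rightarrow> 'a set \<Rightarrow> 'a set set" where
  "star v U = (\<lambda>x. {v, x}) ` U"

lemma finite_pairs: "finite W \<Longrightarrow> finite (pairs W)"
  unfolding pairs_def by (rule finite_subset[of _ "Pow W"]) auto

lemma pairs_insert: "v \<notin> U \<Longrightarrow> pairs (insert v U) = star v U \<union> pairs U"
  unfolding pairs_def star_def by (auto simp: card_2_iff doubleton_eq_iff)

lemma star_disjoint_pairs: "v \<notin> U \<Longrightarrow> star v U \<inter> pairs U = {}"
  unfolding pairs_def star_def by auto

lemma card_star: "v \<notin> U \<Longrightarrow> card (star v U) = card U"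
  unfolding star_def by (intro card_image inj_onI) (auto simp: doubleton_eq_iff)

text \<open>The first step reads only labels in \<open>star v U\<close>, and all later steps only
  labels of edges inside \<open>U\<close>. For a labelling glued from \<open>g\<close> and
  \<open>h\<close>, therefore, \<open>g\<close> decides the step and \<open>h\<close> the
  continuation.\<close>

lemma greedy_walk_merge_Suc:
  fixes g h :: "'a set \<Rightarrow> nat" and l :: nat
  assumes "v \<notin> U"
  defines "f \<equiv> \<lambda>e. if e \<in> star v U then g e else h e" and "x \<equiv> greedy_next g U v l"
  shows "greedy_walk f (Suc k) U v l \<longleftrightarrow>
    (\<exists>e\<in>star v U. l < g e) \<and> greedy_walk h k (U - {x}) x (g {v, x})"
proof -
  have f: "f {v, x} = g {v, x}" if "x \<in> U" for x using that by (auto simp: f_def star_def)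
  have ex: "(\<exists>x\<in>U. l < f {v, x}) \<longleftrightarrow> (\<exists>e\<in>star v U. l < g e)"
    using f by (auto simp: star_def)
  have nxt: "greedy_next f U v l = x"
    unfolding x_def using greedy_next_strict_mono[where A=UNIV and h=id and l=l and U=U and f=g and v=v and g=f] f by (simp add: strict_mono_on_def)
  show ?thesis
  proof (cases "\<exists>e\<in>star v U. l < g e")
    case True
    then have x: "x \<in> U" unfolding x_def by (intro greedy_nextD(1)) (auto simp: star_def)
    have "greedy_walk f k (U - {x}) x (g {v, x}) \<longleftrightarrow> greedy_walk h k (U - {x}) x (g {v, x})"
    proof (rule greedy_walk_cong)
      show "f e = h e" if "e \<in> pairs (insert x (U - {x}))" for e
        using that x star_disjoint_pairs[OF assms(1)] by (auto simp: f_def insert_absorb)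
    qed simp
    then show ?thesis using True ex nxt f[OF x] by (simp add: Let_def)
  next
    case False
    then show ?thesis using ex by simp
  qed
qed

text \<open>Conditioning on the labels at \<open>v\<close>, which the rest of the walk never inspects again.\<close>

lemma prob_greedy_walk_Suc:
  fixes U :: "'a set" and k l :: nat
  assumes U: "finite U" "v \<notin> U" and M: "M \<ge> 1"
  defines "rest \<equiv> \<lambda>g h. let x = greedy_next g U v l in greedy_walk h k (U - {x}) x (g {v, x})"
  shows "measure_pmf.prob (iid_labels M (pairs (insert v U))) {f. greedy_walk f (Suc k) U v l} =
      measure_pmf.expectation (iid_labels M (star v U)) (\<lambda>g. if \<exists>e\<in>star v U. l < g e
        then measure_pmf.prob (iid_labels M (pairs U)) {h. rest g h} else 0)"
    and "measure_pmf.prob (iid_labels M (pairs (insert v U))) {f. \<not> greedy_walk f (Suc k) U v l} =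
      measure_pmf.expectation (iid_labels M (star v U)) (\<lambda>g. if \<exists>e\<in>star v U. l < g e
        then measure_pmf.prob (iid_labels M (pairs U)) {h. \<not> rest g h} else 1)"
proof -
  have fin: "finite (star v U)" "finite (pairs U)" using U finite_pairs by (auto simp: star_def)
  show "measure_pmf.prob (iid_labels M (pairs (insert v U))) {f. greedy_walk f (Suc k) U v l} =
      measure_pmf.expectation (iid_labels M (star v U)) (\<lambda>g. if \<exists>e\<in>star v U. l < g e
        then measure_pmf.prob (iid_labels M (pairs U)) {h. rest g h} else 0)"
    unfolding pairs_insert[OF U(2)] prob_iid_labels_Un[OF fin star_disjoint_pairs[OF U(2)]]
      greedy_walk_merge_Suc[OF U(2)]
    by (rule Bochner_Integration.integral_cong[OF refl], rename_tac g,
      case_tac "\<exists>e\<in>star v U. l < g e") (simp_all add: rest_def Let_def)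
  show "measure_pmf.prob (iid_labels M (pairs (insert v U))) {f. \<not> greedy_walk f (Suc k) U v l} =
      measure_pmf.expectation (iid_labels M (star v U)) (\<lambda>g. if \<exists>e\<in>star v U. l < g e
        then measure_pmf.prob (iid_labels M (pairs U)) {h. \<not> rest g h} else 1)"
    unfolding pairs_insert[OF U(2)] prob_iid_labels_Un[OF fin star_disjoint_pairs[OF U(2)]]
      greedy_walk_merge_Suc[OF U(2)]
    by (rule Bochner_Integration.integral_cong[OF refl], rename_tac g,
      case_tac "\<exists>e\<in>star v U. l < g e") (simp_all add: rest_def Let_def)
qed

text \<open>Supplies the hypothesis on \<open>T\<close> in the two moment lemmas.\<close>

lemma next_label_minimal:
  assumes "\<exists>e\<in>star v U. l < g e"
  shows "\<exists>e\<in>star v U. g {v, greedy_next g U v l} = g e \<and> l < g e \<and>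
    (\<forall>e'\<in>star v U. l < g e' \<longrightarrow> g e \<le> g e')"
proof -
  have "\<exists>x\<in>U. l < g {v, x}" using assms by (auto simp: star_def)
  note D = greedy_nextD[of U l g v, OF this]
  then show ?thesis by (intro bexI[of _ "{v, greedy_next g U v l}"]) (auto simp: star_def)
qed

section \<open>Tail bounds for the walk\<close>

text \<open>Chernoff bound: \<open>k\<close> steps are possible only if the increments sum to at
  most \<open>M - l\<close>. Each step contributes a factor \<open>m / (m + p)\<close>, with
  \<open>m\<close> the current number of unvisited vertices, and these are bounded by factors with a
  telescoping product. Keeping \<open>l\<close> arbitrary turns the exponential factor into the
  potential of the induction.\<close>

lemma prob_greedy_walk_le:
  assumes M: "M \<ge> 1" and p: "p \<ge> 1"
  shows "finite U \<Longrightarrow> v \<notin> U \<Longrightarrow> l \<le> M \<Longrightarrow> (card U)\<^sup>2 \<le> M \<Longrightarrow>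
    measure_pmf.prob (iid_labels M (pairs (insert v U))) {f. greedy_walk f k U v l}
      \<le> exp ((real p + 2) * (real M - real l) / M) * (real (card U - k + p) / real (card U + p)) ^ p"
proof (induction k arbitrary: U v l)
  case 0
  have "1 \<le> exp ((real p + 2) * (real M - real l) / M)" using 0 by simp
  then show ?case using p 0 by simp
next
  case (Suc k)
  note U = \<open>finite U\<close> \<open>v \<notin> U\<close>
  define m where "m = card U"
  let ?T = "\<lambda>g. g {v, greedy_next g U v l}"
  have S: "finite (star v U)" "card (star v U) = m" using U card_star by (auto simp: star_def m_def)
  \<comment> \<open>The bound from the induction hypothesis without its dependence on the new label;
    the remaining factor is averaged by the moment lemma.\<close>
  define R where "R = exp ((real p + 2) * (real M - real l) / M) * (real (m - 1 - k + p) / real (m - 1 + p)) ^ p"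
  have "R \<ge> 0" by (simp add: R_def)
  have "measure_pmf.prob (iid_labels M (pairs (insert v U))) {f. greedy_walk f (Suc k) U v l} \<le>
      measure_pmf.expectation (iid_labels M (star v U)) (\<lambda>g. R *
       (if \<exists>e\<in>star v U. l < g e then exp (- (real p + 2) * (real (?T g) - real l) / M) else 0))"
    unfolding prob_greedy_walk_Suc(1)[OF U M]
  proof (rule expectation_iid_labels_mono[OF S(1) M])
    fix g assume g: "g \<in> star v U \<rightarrow>\<^sub>E {1..M}"
    define x where "x = greedy_next g U v l"
    show "(if \<exists>e\<in>star v U. l < g e then measure_pmf.prob (iid_labels M (pairs U))
           {h. let x = greedy_next g U v l in greedy_walk h k (U - {x}) x (g {v, x})} else 0)
      \<le> R * (if \<exists>e\<in>star v U. l < g e then exp (- (real p + 2) * (real (?T g) - real l) / M) else 0)"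
    proof (cases "\<exists>e\<in>star v U. l < g e")
      case True
      then have x: "x \<in> U" unfolding x_def by (intro greedy_nextD(1)) (auto simp: star_def)
      then have c: "card (U - {x}) = m - 1" by (simp add: m_def)
      have xM: "g {v, x} \<le> M" using g x by (auto simp: star_def)
      have "(m - 1)\<^sup>2 \<le> m\<^sup>2" by (intro power_mono) auto
      then have "(m - 1)\<^sup>2 \<le> M" using Suc.prems(4) unfolding m_def by linarith
      then have "measure_pmf.prob (iid_labels M (pairs (insert x (U - {x})))) {h. greedy_walk h k (U - {x}) x (g {v, x})}
        \<le> exp ((real p + 2) * (real M - real (g {v, x})) / M) * (real (m - 1 - k + p) / real (m - 1 + p)) ^ p"
        using Suc.IH[of "U - {x}" x "g {v, x}"] U xM unfolding c by simp
      also have "(real p + 2) * (real M - real (g {v, x})) / M =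
        (real p + 2) * (real M - real l) / M + - (real p + 2) * (real (g {v, x}) - real l) / M"
        by (simp add: add_divide_distrib[symmetric]) (simp add: algebra_simps)
      finally show ?thesis using True x
        by (simp add: R_def exp_add x_def[symmetric] insert_absorb Let_def mult_ac)
    qed simp
  qed
  also have "\<dots> = R * measure_pmf.expectation (iid_labels M (star v U)) (\<lambda>g.
       (if \<exists>e\<in>star v U. l < g e then exp (- (real p + 2) * (real (?T g) - real l) / M) else 0))"
    by simp
  also have "\<dots> \<le> R * (m / (m + real p))"
    using expectation_exp_minus_next_label[of "star v U" M l "real p" ?T, OF S(1) M _ Suc.prems(3) _ next_label_minimal]
      p \<open>R \<ge> 0\<close> Suc.prems(4) unfolding S(2) m_def[symmetric] by (intro mult_left_mono) auto
  also have "\<dots> \<le> exp ((real p + 2) * (real M - real l) / M) * (real (m - Suc k + p) / real (m + p)) ^ p"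
  proof (cases "m = 0")
    case False
    \<comment> \<open>Bernoulli: \<open>1 - p * x \<le> (1 - x) ^ p\<close> with
      \<open>x = 1 / (m + p)\<close>. The right side is a power of a ratio of consecutive numbers,
      which cancels against the induction hypothesis.\<close>
    have "m / (m + real p) = 1 + real p * (- 1 / (m + real p))" using p by (simp add: field_simps)
    also have "\<dots> \<le> (1 + - 1 / (m + real p)) ^ p"
      using p False by (intro Bernoulli_inequality) (simp add: field_simps)
    also have "1 + - 1 / (m + real p) = real (m - 1 + p) / real (m + p)"
      using False p by (simp add: field_simps of_nat_diff)
    finally have "R * (m / (m + real p)) \<le> R * (real (m - 1 + p) / real (m + p)) ^ p"
      using \<open>R \<ge> 0\<close> by (rule mult_left_mono)
    also have "\<dots> = exp ((real p + 2) * (real M - real l) / M) *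
        (real (m - 1 - k + p) / real (m - 1 + p) * (real (m - 1 + p) / real (m + p))) ^ p"
      unfolding R_def power_mult_distrib by simp
    also have "real (m - 1 - k + p) / real (m - 1 + p) * (real (m - 1 + p) / real (m + p))
        = real (m - 1 - k + p) / real (m + p)"
      using p by simp
    finally show ?thesis by simp
  qed simp
  finally show ?case by (simp add: m_def)
qed

text \<open>The opposite Chernoff bound: stopping early means that few increments, the last one
  capped, add up to \<open>M - l\<close>. The assumption \<open>k + p + 1 \<le> card U\<close> keeps
  every denominator positive along the induction.\<close>

lemma prob_not_greedy_walk_le:
  assumes p: "p \<ge> 1"
  shows "finite U \<Longrightarrow> v \<notin> U \<Longrightarrow> l \<le> M \<Longrightarrow> (card U)\<^sup>2 + p \<le> M \<Longrightarrow> k + p + 1 \<le> card U \<Longrightarrow>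
    measure_pmf.prob (iid_labels M (pairs (insert v U))) {f. \<not> greedy_walk f k U v l}
      \<le> exp (- (real p * (real M - real l) / M)) * (real (card U - p) / real (card U - p - k)) ^ p"
proof (induction k arbitrary: U v l)
  case 0
  then show ?case by simp
next
  case (Suc k)
  note U = \<open>finite U\<close> \<open>v \<notin> U\<close>
  define m where "m = card U"
  have M: "M \<ge> 1" using Suc.prems(4) p by simp
  have m: "p + 2 \<le> m" "m - 1 - p \<ge> 1" "k + p + 1 \<le> m - 1" using Suc.prems(5) by (auto simp: m_def)
  let ?T = "\<lambda>g. g {v, greedy_next g U v l}"
  have S: "finite (star v U)" "card (star v U) = m" using U card_star by (auto simp: star_def m_def)
  define R where "R = exp (- (real p * (real M - real l) / M)) * (real (m - 1 - p) / real (m - 1 - p - k)) ^ p"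
  have "R \<ge> 0" by (simp add: R_def)
  have "measure_pmf.prob (iid_labels M (pairs (insert v U))) {f. \<not> greedy_walk f (Suc k) U v l} \<le>
      measure_pmf.expectation (iid_labels M (star v U)) (\<lambda>g. R *
       exp (real p * (real (if \<exists>e\<in>star v U. l < g e then ?T g else M) - real l) / M))"
    unfolding prob_greedy_walk_Suc(2)[OF U M]
  proof (rule expectation_iid_labels_mono[OF S(1) M])
    fix g assume g: "g \<in> star v U \<rightarrow>\<^sub>E {1..M}"
    define x where "x = greedy_next g U v l"
    show "(if \<exists>e\<in>star v U. l < g e then measure_pmf.prob (iid_labels M (pairs U))
           {h. \<not> (let x = greedy_next g U v l in greedy_walk h k (U - {x}) x (g {v, x}))} else 1)
      \<le> R * exp (real p * (real (if \<exists>e\<in>star v U. l < g e then ?T g else M) - real l) / M)"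
    proof (cases "\<exists>e\<in>star v U. l < g e")
      case True
      then have x: "x \<in> U" unfolding x_def by (intro greedy_nextD(1)) (auto simp: star_def)
      then have c: "card (U - {x}) = m - 1" by (simp add: m_def)
      have xM: "g {v, x} \<le> M" using g x by (auto simp: star_def)
      have "(m - 1)\<^sup>2 \<le> m\<^sup>2" by (intro power_mono) auto
      then have "(m - 1)\<^sup>2 + p \<le> M" using Suc.prems(4) unfolding m_def by linarith
      then have "measure_pmf.prob (iid_labels M (pairs (insert x (U - {x})))) {h. \<not> greedy_walk h k (U - {x}) x (g {v, x})}
        \<le> exp (- (real p * (real M - real (g {v, x})) / M)) * (real (m - 1 - p) / real (m - 1 - p - k)) ^ p"
        using Suc.IH[of "U - {x}" x "g {v, x}"] U xM m(3) unfolding c by simp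
      also have "exp (- (real p * (real M - real (g {v, x})) / M)) =
        exp (- (real p * (real M - real l) / M)) * exp (real p * (real (g {v, x}) - real l) / M)"
        unfolding exp_add[symmetric] using M by (intro arg_cong[where f=exp]) (simp add: field_simps)
      finally show ?thesis using True x
        by (simp add: R_def exp_add x_def[symmetric] insert_absorb Let_def mult_ac)
    next
      case False
      \<comment> \<open>The walk stops here, so failure is certain. The capped increment cancels the
        exponential in \<open>R\<close> exactly and leaves a power of a ratio that is at least
        1.\<close>
      have "1 \<le> real (m - 1 - p) / real (m - 1 - p - k)" using m by (simp add: field_simps)
      then have "1 \<le> (real (m - 1 - p) / real (m - 1 - p - k)) ^ p" by (rule one_le_power)
      also have "\<dots> = R * exp (real p * (real M - real l) / M)"
        by (simp add: R_def exp_minus)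
      finally show ?thesis using False by simp
    qed
  qed
  also have "\<dots> = R * measure_pmf.expectation (iid_labels M (star v U)) (\<lambda>g.
       exp (real p * (real (if \<exists>e\<in>star v U. l < g e then ?T g else M) - real l) / M))"
    by simp
  also have "\<dots> \<le> R * ((m - 1) / (m - 1 - real p))"
  proof (rule mult_left_mono[OF _ \<open>R \<ge> 0\<close>])
    have "real (m\<^sup>2) + real p \<le> real M" using Suc.prems(4) unfolding m_def by (metis of_nat_add of_nat_le_iff)
    moreover have "real p + 1 < real m" using m by linarith
    ultimately show "measure_pmf.expectation (iid_labels M (star v U)) (\<lambda>g.
       exp (real p * (real (if \<exists>e\<in>star v U. l < g e then ?T g else M) - real l) / M)) \<le> (m - 1) / (m - 1 - real p)"
      using expectation_exp_next_label[of "star v U" "real p" M l ?T, OF S(1) _ _ Suc.prems(3) _ next_label_minimal]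
        p m unfolding S(2) by (simp add: of_nat_diff)
  qed
  also have "\<dots> \<le> exp (- (real p * (real M - real l) / M)) * (real (m - p) / real (m - p - Suc k)) ^ p"
  proof -
    \<comment> \<open>Bernoulli again, now \<open>1 + p * x \<le> (1 + x) ^ p\<close> with
      \<open>x = 1 / (m - 1 - p)\<close>, to obtain a telescoping factor.\<close>
    have "(m - 1) / (m - 1 - real p) = 1 + real p * (1 / (m - 1 - real p))"
      using m by (simp add: field_simps)
    also have "\<dots> \<le> (1 + 1 / (m - 1 - real p)) ^ p"
      using m by (intro Bernoulli_inequality) (simp add: field_simps)
    also have "1 + 1 / (m - 1 - real p) = real (m - p) / real (m - 1 - p)"
      using m by (simp add: field_simps of_nat_diff)
    finally have "R * ((m - 1) / (m - 1 - real p)) \<le> R * (real (m - p) / real (m - 1 - p)) ^ p"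
      using \<open>R \<ge> 0\<close> by (rule mult_left_mono)
    also have "\<dots> = exp (- (real p * (real M - real l) / M)) *
        (real (m - 1 - p) / real (m - 1 - p - k) * (real (m - p) / real (m - 1 - p))) ^ p"
      unfolding R_def power_mult_distrib by simp
    also have "real (m - 1 - p) / real (m - 1 - p - k) * (real (m - p) / real (m - 1 - p))
        = real (m - p) / real (m - 1 - p - k)"
      using m by simp
    also have "m - 1 - p - k = m - p - Suc k" by simp
    finally show ?thesis by simp
  qed
  finally show ?case by (simp add: m_def)
qed

section \<open>From independent labels to uniform edge orderings\<close>

text \<open>The increasing enumeration of \<open>S\<close>, extended by \<open>h 0 = 0\<close> so
  that the initial threshold of the walk is preserved.\<close>

lemma ex_strict_mono_onto:
  assumes S: "finite S" "card S = N" "0 \<notin> S"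
  shows "\<exists>h :: nat \<Rightarrow> nat. h 0 = 0 \<and> strict_mono_on {0..N} h \<and> h ` {1..N} = S"
proof -
  obtain b where b: "bij_betw b {..<card S} S" "strict_mono_on {..<card S} b"
    using ex_bij_betw_strict_mono_card[OF S(1)] by blast
  define h where "h i = (if i = 0 then 0 else b (i - 1))" for i
  have "b i \<in> S" if "i < N" for i using b(1) S that by (auto simp: bij_betw_def)
  then have "b i > 0" if "i < N" for i using S(3) that by (metis gr0I)
  moreover have "b (r - 1) < b (s - 1)" if "0 < r" "r < s" "s \<le> N" for r s
    using that S(2) by (intro strict_mono_onD[OF b(2)]) auto
  ultimately have "strict_mono_on {0..N} h"
    unfolding strict_mono_on_def h_def by auto
  moreover have "h ` {1..N} = b ` {..<N}"
  proof -
    have "h ` {1..N} = h ` (Suc ` {..<N})" by (simp only: image_Suc_lessThan)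
    also have "\<dots> = b ` {..<N}" unfolding image_image h_def by simp
    finally show ?thesis .
  qed
  ultimately show ?thesis using b(1) S(2) by (intro exI[of _ h]) (auto simp: h_def bij_betw_def)
qed

text \<open>Composing one fixed ordering with the permutations of the label set gives distinct
  orderings.\<close>

lemma card_edge_orderings_ge: "fact (n choose 2) \<le> card (edge_orderings n)"
proof -
  let ?E = "complete_edges n" and ?N = "n choose 2"
  obtain b where b: "bij_betw b ?E {1..?N}"
    using edge_orderings_nonempty[of n] by (auto simp: edge_orderings_def)
  let ?F = "\<lambda>p. restrict (p \<circ> b) ?E"
  have "inj_on ?F {p. p permutes {1..?N}}"
  proof (rule inj_onI, rule ext)
    fix p p' x
    assume p: "p \<in> {p. p permutes {1..?N}}" "p' \<in> {p. p permutes {1..?N}}" and eq: "?F p = ?F p'"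
    show "p x = p' x"
    proof (cases "x \<in> {1..?N}")
      case True
      then obtain e where e: "e \<in> ?E" "x = b e" using b unfolding bij_betw_def by blast
      then show ?thesis using fun_cong[OF eq, of e] by simp
    next
      case False
      then show ?thesis using p by (auto simp: permutes_def)
    qed
  qed
  moreover have "?F ` {p. p permutes {1..?N}} \<subseteq> edge_orderings n"
  proof safe
    fix p assume "p permutes {1..?N}"
    then have "bij_betw (p \<circ> b) ?E {1..?N}"
      using b permutes_imp_bij bij_betw_trans by blast
    then show "?F p \<in> edge_orderings n"
      unfolding edge_orderings_def by (auto cong: bij_betw_cong)
  qed
  ultimately have "card {p. p permutes {1..?N}} \<le> card (edge_orderings n)"
    using finite_edge_orderings card_inj_on_le by blast
  then show ?thesis by (simp add: card_permutations)
qed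

text \<open>An edge ordering and the set of values taken by the labels together encode an injective labelling.\<close>

lemma card_edge_orderings_times_choose_le:
  fixes Q :: "(nat set \<Rightarrow> nat) \<Rightarrow> bool"
  assumes Q: "\<And>f g h. f \<in> edge_orderings n \<Longrightarrow> h 0 = 0 \<Longrightarrow> strict_mono_on {0..n choose 2} h \<Longrightarrow>
      (\<And>e. e \<in> complete_edges n \<Longrightarrow> g e = h (f e)) \<Longrightarrow> Q f \<Longrightarrow> Q g"
  shows "card {f \<in> edge_orderings n. Q f} * (M choose (n choose 2))
    \<le> card {g \<in> complete_edges n \<rightarrow>\<^sub>E {1..M}. Q g}"
proof -
  define E where "E = complete_edges n"
  define N where "N = n choose 2"
  define C where "C = {S. S \<subseteq> {1..M} \<and> card S = N}"
  have "\<exists>h :: nat \<Rightarrow> nat. h 0 = 0 \<and> strict_mono_on {0..N} h \<and> h ` {1..N} = S" if "S \<in> C" for S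
    using that by (intro ex_strict_mono_onto) (auto simp: C_def intro: finite_subset)
  then obtain h :: "nat set \<Rightarrow> nat \<Rightarrow> nat" where
    h: "\<And>S. S \<in> C \<Longrightarrow> h S 0 = 0 \<and> strict_mono_on {0..N} (h S) \<and> h S ` {1..N} = S"
    by metis
  define F where "F = (\<lambda>(f, S). restrict (h S \<circ> f) E)"
  have fE: "f ` E = {1..N}" "f \<in> extensional E" if "f \<in> edge_orderings n" for f
    using that by (auto simp: edge_orderings_def bij_betw_def E_def N_def)
  \<comment> \<open>The range of the labelling recovers \<open>S\<close>; injectivity of
    \<open>h S\<close> then recovers \<open>f\<close>.\<close>
  have FE: "F (f, S) ` E = S" if "f \<in> edge_orderings n" "S \<in> C" for f S
  proof -
    have "F (f, S) ` E = h S ` (f ` E)" by (simp add: F_def image_image)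
    then show ?thesis using fE(1)[OF that(1)] h[OF that(2)] by simp
  qed
  have "inj_on F ({f \<in> edge_orderings n. Q f} \<times> C)"
  proof (rule inj_onI, clarify, rule conjI)
    fix f S f' S'
    assume f: "f \<in> edge_orderings n" "f' \<in> edge_orderings n" and S: "S \<in> C" "S' \<in> C"
      and eq: "F (f, S) = F (f', S')"
    show "S = S'" using FE[OF f(1) S(1)] FE[OF f(2) S(2)] eq by simp
    have "inj_on (h S) {0..N}" using h[OF S(1)] strict_mono_on_imp_inj_on by blast
    have "f e = f' e" if "e \<in> E" for e
    proof -
      have "h S (f e) = h S (f' e)"
        using fun_cong[OF eq, of e] \<open>S = S'\<close> that by (simp add: F_def)
      moreover have "f e \<in> {0..N}" "f' e \<in> {0..N}" using fE(1) f that by (force)+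
      ultimately show ?thesis using \<open>inj_on (h S) {0..N}\<close> by (simp add: inj_on_def)
    qed
    then show "f = f'" using fE(2) f by (intro extensionalityI)
  qed
  moreover have "F ` ({f \<in> edge_orderings n. Q f} \<times> C) \<subseteq> {g \<in> E \<rightarrow>\<^sub>E {1..M}. Q g}"
  proof (clarify, rule conjI)
    fix f S assume f: "f \<in> edge_orderings n" "Q f" and S: "S \<in> C"
    have "F (f, S) e \<in> {1..M}" if "e \<in> E" for e
      using FE[OF f(1) S] S that unfolding C_def by blast
    then show "F (f, S) \<in> E \<rightarrow>\<^sub>E {1..M}" by (auto simp: F_def)
    show "Q (F (f, S))"
    proof (rule Q[OF f(1) _ _ _ f(2)])
      show "h S 0 = 0" "strict_mono_on {0..n choose 2} (h S)" using h[OF S] by (simp_all add: N_def)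
      show "F (f, S) e = h S (f e)" if "e \<in> complete_edges n" for e
        using that by (simp add: F_def E_def)
    qed
  qed
  moreover have "finite (E \<rightarrow>\<^sub>E {1..M})"
    by (intro finite_PiE) (auto simp: E_def finite_complete_edges)
  ultimately have "card ({f \<in> edge_orderings n. Q f} \<times> C) \<le> card {g \<in> E \<rightarrow>\<^sub>E {1..M}. Q g}"
    by (intro card_inj_on_le) auto
  then show ?thesis by (simp add: card_cartesian_product C_def n_subsets E_def N_def)
qed

text \<open>At least half of all labellings of \<open>N\<close> edges are injective: the falling
  factorial is at least \<open>(M - N) ^ N\<close>, and Bernoulli bounds
  \<open>(1 - N / M) ^ N\<close> below by \<open>1 - N\<^sup>2 / M\<close>.\<close>

lemma half_power_le_fact_times_choose:
  assumes M: "2 * N\<^sup>2 \<le> M" "M \<ge> 1"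
  shows "real M ^ N / 2 \<le> fact N * real (M choose N)"
proof -
  have "real (2 * N\<^sup>2) \<le> real M" using M(1) by (rule of_nat_mono)
  then have NM: "real N * (real N / M) \<le> 1 / 2" using M(2) by (simp add: field_simps power2_eq_square)
  have "N \<le> M" using M by (metis le_square le_trans mult_2 le_add1 power2_eq_square)
  have "1 / 2 \<le> 1 + real N * (- (real N / M))" using NM by simp
  also have "\<dots> \<le> (1 + - (real N / M)) ^ N"
    using \<open>N \<le> M\<close> M by (intro Bernoulli_inequality) simp
  finally have "real M ^ N * (1 / 2) \<le> real M ^ N * (1 + - (real N / M)) ^ N"
    by (rule mult_left_mono) simp
  then have "real M ^ N / 2 \<le> real M ^ N * (1 + - (real N / M)) ^ N" by simp
  also have "\<dots> = (\<Prod>i = 0..<N. real M - real N)"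
    using M by (simp add: power_mult_distrib[symmetric] algebra_simps)
  also have "\<dots> \<le> (\<Prod>i = 0..<N. real M - real i)"
    using \<open>N \<le> M\<close> by (intro prod_mono) auto
  also have "\<dots> = fact N * real (M choose N)"
    by (simp add: gbinomial_mult_fact[symmetric] binomial_gbinomial)
  finally show ?thesis .
qed

text \<open>The quotient of the two counting bounds; the factor 2 is the price of conditioning on
  injectivity. \<open>Q\<close> need only be preserved in one direction, from an ordering to its
  increasing relabellings.\<close>

lemma prob_edge_orderings_le:
  fixes Q :: "(nat set \<Rightarrow> nat) \<Rightarrow> bool"
  assumes M: "2 * (n choose 2)\<^sup>2 \<le> M" "M \<ge> 1"
    and Q: "\<And>f g h. f \<in> edge_orderings n \<Longrightarrow> h 0 = 0 \<Longrightarrow> strict_mono_on {0..n choose 2} h \<Longrightarrow>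
      (\<And>e. e \<in> complete_edges n \<Longrightarrow> g e = h (f e)) \<Longrightarrow> Q f \<Longrightarrow> Q g"
  shows "measure_pmf.prob (pmf_of_set (edge_orderings n)) {f. Q f}
    \<le> 2 * measure_pmf.prob (iid_labels M (complete_edges n)) {g. Q g}"
proof -
  define N where "N = n choose 2"
  define a b c where "a = real (card {f \<in> edge_orderings n. Q f})"
    and "b = real (card {g \<in> complete_edges n \<rightarrow>\<^sub>E {1..M}. Q g})" and "c = real (card (edge_orderings n))"
  have PO: "measure_pmf.prob (pmf_of_set (edge_orderings n)) {f. Q f} = a / c"
    by (simp add: measure_pmf_of_set edge_orderings_nonempty finite_edge_orderings Int_def a_def c_def)
  have ne: "complete_edges n \<rightarrow>\<^sub>E {1..M} \<noteq> {}" using M by (simp add: PiE_eq_empty_iff)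
  have "measure_pmf.prob (iid_labels M (complete_edges n)) {g. Q g} = b / real M ^ N"
    unfolding iid_labels_eq_pmf_of_set[OF finite_complete_edges M(2)]
    using ne M finite_PiE[OF finite_complete_edges[of n], of "\<lambda>_. {1..M}"]
    by (simp add: measure_pmf_of_set Int_def b_def N_def card_PiE finite_complete_edges card_complete_edges)
  moreover have "a / c \<le> 2 * (b / real M ^ N)"
  proof -
    have le: "a * real (M choose N) \<le> b"
    proof -
      have "card {f \<in> edge_orderings n. Q f} * (M choose (n choose 2))
          \<le> card {g \<in> complete_edges n \<rightarrow>\<^sub>E {1..M}. Q g}"
        by (rule card_edge_orderings_times_choose_le) (fact Q)
      from of_nat_mono[OF this, where 'a=real] show ?thesis
        by (simp add: a_def b_def N_def)
    qed
    have c0: "c > 0"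
      by (simp add: c_def card_gt_0_iff edge_orderings_nonempty finite_edge_orderings)
    have "fact N \<le> c" unfolding c_def N_def using card_edge_orderings_ge[of n]
      by (metis of_nat_fact of_nat_le_iff)
    then have "real M ^ N / 2 \<le> c * real (M choose N)"
      using half_power_le_fact_times_choose[of N M] M unfolding N_def
      by (meson mult_right_mono of_nat_0_le_iff order_trans)
    then have "a * (real M ^ N / 2) \<le> a * (c * real (M choose N))"
      by (rule mult_left_mono) (simp add: a_def)
    also have "\<dots> \<le> c * b" using mult_left_mono[OF le, of c] c0 by (simp add: mult_ac)
    finally show ?thesis using c0 M by (simp add: field_simps)
  qed
  ultimately show ?thesis using PO by simp
qed

lemma pairs_eq_complete_edges: "pairs {..<n} = complete_edges n"
  by (simp add: pairs_def complete_edges_def)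

section \<open>Tail bounds for the path length\<close>

lemma prob_path_length_bounds:
  assumes v: "v < n" and n: "n \<ge> 2" and p: "p \<ge> 1"
  shows "measure_pmf.prob (pmf_of_set (edge_orderings n)) {f. k \<le> path_length (greedy_path n f v)}
      \<le> 2 * (exp (real p + 2) * (real (n - 1 - k + p) / real (n - 1 + p)) ^ p)" (is ?upper)
    and "k + p + 2 \<le> n \<Longrightarrow>
      measure_pmf.prob (pmf_of_set (edge_orderings n)) {f. \<not> k \<le> path_length (greedy_path n f v)}
      \<le> 2 * (exp (- real p) * (real (n - 1 - p) / real (n - 1 - p - k)) ^ p)" (is "_ \<Longrightarrow> ?lower")
proof -
  define U where "U = {..<n} - {v}"
  \<comment> \<open>The first summand makes half of the labellings injective, the others meet the
    size conditions of the walk bounds. With \<open>l = 0\<close> those bounds no longer contain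
    \<open>M\<close>.\<close>
  define M where "M = 2 * (n choose 2)\<^sup>2 + n\<^sup>2 + p"
  have U: "finite U" "v \<notin> U" "insert v U = {..<n}" "card U = n - 1" using v by (auto simp: U_def)
  have "(n - 1)\<^sup>2 + p \<le> n\<^sup>2 + p" by (intro add_right_mono power_mono) auto
  also have "\<dots> \<le> M" unfolding M_def by simp
  finally have M: "2 * (n choose 2)\<^sup>2 \<le> M" "M \<ge> 1" "(n - 1)\<^sup>2 + p \<le> M" "(n - 1)\<^sup>2 \<le> M"
    using p by (simp_all add: M_def)
  have inv: "greedy_walk g k U v 0 \<longleftrightarrow> greedy_walk f k U v 0"
    if f: "f \<in> edge_orderings n" and h: "h 0 = 0" "strict_mono_on {0..n choose 2} h"
      and g: "\<And>e. e \<in> complete_edges n \<Longrightarrow> g e = h (f e)" for f g h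
  proof -
    have "f e \<in> {0..n choose 2} \<and> g e = h (f e)" if "e \<in> pairs (insert v U)" for e
      using that f g unfolding U(3) pairs_eq_complete_edges edge_orderings_def bij_betw_def by auto
    from greedy_walk_strict_mono[where k=k, OF h(2) _ U(2) this, of 0] show ?thesis by (simp add: h(1))
  qed
  have walk: "greedy_walk f k U v 0 \<longleftrightarrow> k \<le> path_length (greedy_path n f v)"
    if f: "f \<in> edge_orderings n" for f
    unfolding U_def greedy_path_def
    using greedy_walk_greedy_path[OF f theI'[OF greedy_path_ex1[OF f n v]]] .
  \<comment> \<open>Stated for a Boolean function \<open>P\<close> to serve both the event and its
    complement.\<close>
  have cong: "measure_pmf.prob (pmf_of_set (edge_orderings n)) {f. P (k \<le> path_length (greedy_path n f v))}
    = measure_pmf.prob (pmf_of_set (edge_orderings n)) {f. P (greedy_walk f k U v 0)}" for P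
    using walk by (intro measure_pmf.finite_measure_eq_AE)
      (auto simp: AE_measure_pmf_iff edge_orderings_nonempty finite_edge_orderings)
  have "measure_pmf.prob (pmf_of_set (edge_orderings n)) {f. greedy_walk f k U v 0}
    \<le> 2 * measure_pmf.prob (iid_labels M (complete_edges n)) {f. greedy_walk f k U v 0}"
    by (rule prob_edge_orderings_le[OF M(1,2)]) (use inv in blast)
  also have "\<dots> \<le> 2 * (exp (real p + 2) * (real (n - 1 - k + p) / real (n - 1 + p)) ^ p)"
    using prob_greedy_walk_le[OF M(2) p U(1,2), of 0 k] M
    unfolding U(3,4) pairs_eq_complete_edges by (intro mult_left_mono) auto
  finally show ?upper using cong[of "\<lambda>x. x"] by simp
  show ?lower if k: "k + p + 2 \<le> n"
  proof -
    have "measure_pmf.prob (pmf_of_set (edge_orderings n)) {f. \<not> greedy_walk f k U v 0}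
      \<le> 2 * measure_pmf.prob (iid_labels M (complete_edges n)) {f. \<not> greedy_walk f k U v 0}"
      by (rule prob_edge_orderings_le[OF M(1,2)]) (use inv in blast)
    also have "\<dots> \<le> 2 * (exp (- real p) * (real (n - 1 - p) / real (n - 1 - p - k)) ^ p)"
      using prob_not_greedy_walk_le[OF p U(1,2), of 0 M k] M k
      unfolding U(3,4) pairs_eq_complete_edges by (intro mult_left_mono) auto
    finally show ?thesis using cong[of Not] by simp
  qed
qed

section \<open>Passage to the limit\<close>

text \<open>Turns convergence for each fixed tolerance into convergence for one vanishing tolerance.
  \<open>Inf (A n)\<close> is the least tolerance that also bounds its own failure probability, as
  in the Ky Fan metric.\<close>

lemma exists_vanishing_tolerance:
  fixes P :: "nat \<Rightarrow> real \<Rightarrow> real"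
  assumes bounds: "\<And>n \<epsilon>. 0 \<le> P n \<epsilon>" "\<And>n \<epsilon>. P n \<epsilon> \<le> 1" and mono: "\<And>n. mono (P n)"
    and lim: "\<And>\<epsilon>. 0 < \<epsilon> \<Longrightarrow> (\<lambda>n. P n \<epsilon>) \<longlonglongrightarrow> 1"
  shows "\<exists>\<delta>. \<delta> \<in> o(\<lambda>_. 1) \<and> (\<lambda>n. P n (\<delta> n)) \<longlonglongrightarrow> 1"
proof -
  define A where "A n = {\<epsilon>. 0 < \<epsilon> \<and> 1 - P n \<epsilon> \<le> \<epsilon>}" for n
  \<comment> \<open>The infimum need not be attained; the vanishing extra term puts
    \<open>\<delta> n\<close> strictly above some member of \<open>A n\<close>, and monotonicity
    does the rest.\<close>
  define \<delta> where "\<delta> n = Inf (A n) + 1 / real (Suc n)" for n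
  have "1 \<in> A n" for n using bounds by (simp add: A_def)
  then have ne: "A n \<noteq> {}" for n by blast
  have bdd: "bdd_below (A n)" for n by (rule bdd_belowI[of _ 0]) (simp add: A_def)
  have Inf_nonneg: "0 \<le> Inf (A n)" for n by (rule cInf_greatest[OF ne]) (simp add: A_def)
  have "(\<lambda>n. Inf (A n)) \<longlonglongrightarrow> 0"
  proof (rule order_tendstoI)
    show "\<forall>\<^sub>F n in sequentially. a < Inf (A n)" if "a < 0" for a
      by (intro always_eventually allI less_le_trans[OF that Inf_nonneg])
    show "\<forall>\<^sub>F n in sequentially. Inf (A n) < a" if "0 < a" for a
    proof -
      have "\<forall>\<^sub>F n in sequentially. 1 - a / 2 < P n (a / 2)"
        using that by (intro order_tendstoD(1)[OF lim]) auto
      then show ?thesis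
      proof eventually_elim
        case (elim n)
        then have "Inf (A n) \<le> a / 2" using that by (intro cInf_lower bdd) (simp add: A_def)
        then show ?case using that by simp
      qed
    qed
  qed
  moreover have "(\<lambda>n. 1 / real (Suc n)) \<longlonglongrightarrow> 0" by (rule LIMSEQ_Suc[OF lim_1_over_n])
  ultimately have \<delta>: "\<delta> \<longlonglongrightarrow> 0" unfolding \<delta>_def[abs_def] by (rule tendsto_add_zero)
  have ge: "1 - \<delta> n \<le> P n (\<delta> n)" for n
  proof -
    have "Inf (A n) < \<delta> n" by (simp add: \<delta>_def)
    then obtain \<epsilon> where "\<epsilon> \<in> A n" "\<epsilon> < \<delta> n" using cInf_lessD[OF ne] by blast
    moreover from this have "P n \<epsilon> \<le> P n (\<delta> n)" by (intro monoD[OF mono]) simp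
    ultimately show ?thesis by (simp add: A_def)
  qed
  have "(\<lambda>n. 1 - \<delta> n) \<longlonglongrightarrow> 1"
    using tendsto_diff[OF tendsto_const \<delta>, of 1] by simp
  from tendsto_sandwich[OF _ _ this tendsto_const] have "(\<lambda>n. P n (\<delta> n)) \<longlonglongrightarrow> 1"
    using ge bounds(2) by simp
  moreover have "\<delta> \<in> o(\<lambda>_. 1)" using \<delta> by (intro smalloI_tendsto) auto
  ultimately show ?thesis by blast
qed

text \<open>The two tail bounds at \<open>k\<close> near \<open>(1 - c) * n\<close> and
  \<open>(1 - d) * n\<close>, with rounding absorbed in the constants. Their limits are geometric in
  \<open>p\<close>, with ratio below 1 exactly when \<open>c < 1 / exp 1\<close> and
  \<open>d > 1 / exp 1\<close>.\<close>

lemma tail_bounds_tendsto: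
  fixes c d :: real
  assumes "c > 0" "d > 0"
  shows "(\<lambda>n. 2 * (exp (real p + 2) * ((c * real n + real p) / (real n - 1 + real p)) ^ p))
      \<longlonglongrightarrow> 2 * exp 2 * (exp 1 * c) ^ p"
    and "(\<lambda>n. 2 * (exp (- real p) * (real n / (d * real n - 2 - real p)) ^ p))
      \<longlonglongrightarrow> 2 * (1 / (exp 1 * d)) ^ p"
proof -
  have ep: "exp (real p) = exp 1 ^ p" by (simp add: exp_of_nat_mult[symmetric])
  have "(\<lambda>n. (c * real n + real p) / (real n - 1 + real p)) \<longlonglongrightarrow> c"
    using assms(1) by real_asymp
  then have "(\<lambda>n. 2 * (exp (real p + 2) * ((c * real n + real p) / (real n - 1 + real p)) ^ p))
      \<longlonglongrightarrow> 2 * (exp (real p + 2) * c ^ p)"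
    by (intro tendsto_mult tendsto_const tendsto_power)
  then show "(\<lambda>n. 2 * (exp (real p + 2) * ((c * real n + real p) / (real n - 1 + real p)) ^ p))
      \<longlonglongrightarrow> 2 * exp 2 * (exp 1 * c) ^ p"
    by (simp add: exp_add ep power_mult_distrib mult_ac)
  define q where "q = 2 + real p"
  have "(\<lambda>n. (d * real n - q) / real n) \<longlonglongrightarrow> d"
    using assms(2) by real_asymp
  then have "(\<lambda>n. inverse ((d * real n - q) / real n)) \<longlonglongrightarrow> inverse d"
    using assms(2) by (intro tendsto_inverse) auto
  then have "(\<lambda>n. real n / (d * real n - 2 - real p)) \<longlonglongrightarrow> 1 / d"
    by (simp add: q_def divide_inverse mult.commute diff_diff_eq)
  then have "(\<lambda>n. 2 * (exp (- real p) * (real n / (d * real n - 2 - real p)) ^ p))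
      \<longlonglongrightarrow> 2 * (exp (- real p) * (1 / d) ^ p)"
    by (intro tendsto_mult tendsto_const tendsto_power)
  then show "(\<lambda>n. 2 * (exp (- real p) * (real n / (d * real n - 2 - real p)) ^ p))
      \<longlonglongrightarrow> 2 * (1 / (exp 1 * d)) ^ p"
    by (simp add: exp_minus ep power_mult_distrib power_divide divide_inverse power_inverse mult_ac)
qed

lemma prob_path_length_concentration:
  fixes v :: "nat \<Rightarrow> nat"
  assumes v: "\<And>n. n \<ge> 1 \<Longrightarrow> v n < n" and \<epsilon>: "0 < \<epsilon>" "\<epsilon> \<le> 1 / 4"
  shows "(\<lambda>n. measure_pmf.prob (pmf_of_set (edge_orderings n))
      {f. \<bar>real (path_length (greedy_path n f (v n))) - (1 - 1 / exp 1) * real n\<bar> \<le> \<epsilon> * real n}) \<longlonglongrightarrow> 1"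
proof (rule order_tendstoI)
  let ?P = "\<lambda>n. measure_pmf.prob (pmf_of_set (edge_orderings n))"
  let ?good = "\<lambda>n. {f. \<bar>real (path_length (greedy_path n f (v n))) - (1 - 1 / exp 1) * real n\<bar> \<le> \<epsilon> * real n}"
  show "\<forall>\<^sub>F n in sequentially. ?P n (?good n) < a" if "1 < a" for a
    by (intro always_eventually allI le_less_trans[OF measure_pmf.prob_le_1 that])
  fix a :: real assume "a < 1"
  define \<eta> where "\<eta> = 1 - a"
  have "\<eta> > 0" using \<open>a < 1\<close> by (simp add: \<eta>_def)
  \<comment> \<open>The approximate fractions of vertices left unvisited by paths at the upper and
    lower end of the tolerated range. The bound 1/4 on the tolerance keeps \<open>c\<close> and
    \<open>1 - d\<close> positive.\<close>
  define c d where "c = 1 / exp 1 - \<epsilon>" and "d = 1 / exp 1 + \<epsilon>"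
  have "exp 1 \<le> (3 :: real)" by (rule exp_le)
  then have "1 / 3 \<le> 1 / (exp 1 :: real)" by (intro divide_left_mono) auto
  then have c: "0 < c" and d: "0 < d" using \<epsilon> unfolding c_def d_def by linarith+
  have "exp 1 * c = 1 - exp 1 * \<epsilon>" "exp 1 * d = 1 + exp 1 * \<epsilon>"
    by (simp_all add: c_def d_def right_diff_distrib distrib_left)
  moreover have ecd0: "0 < exp 1 * c" "0 < exp 1 * \<epsilon>" using c \<epsilon> by simp_all
  ultimately have ecd: "exp 1 * c < 1" "1 < exp 1 * d" by linarith+
  have "norm (exp 1 * c) < 1" "norm (1 / (exp 1 * d)) < 1" using ecd0 ecd by (simp_all only: real_norm_def abs_if) auto
  note pow = this[THEN LIMSEQ_power_zero]
  have "\<eta> / 2 > 0" using \<open>\<eta> > 0\<close> by simp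
  note order_tendstoD(2)[OF tendsto_mult_right_zero[OF pow(1), of "2 * exp 2"] this]
    order_tendstoD(2)[OF tendsto_mult_right_zero[OF pow(2), of 2] this]
  \<comment> \<open>The order of limits matters: \<open>p\<close> is fixed first so that both
    limiting bounds drop below \<open>\<eta> / 2\<close>, and only then does \<open>n\<close>
    grow.\<close>
  then have "\<forall>\<^sub>F p in sequentially. 2 * exp 2 * (exp 1 * c) ^ p < \<eta> / 2 \<and> 2 * (1 / (exp 1 * d)) ^ p < \<eta> / 2 \<and> p \<ge> 1"
    by (intro eventually_conj eventually_ge_at_top)
  then obtain p where p: "2 * exp 2 * (exp 1 * c) ^ p < \<eta> / 2" "2 * (1 / (exp 1 * d)) ^ p < \<eta> / 2" "p \<ge> 1"
    using eventually_happens'[OF sequentially_bot] by blast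
  \<comment> \<open>This yields \<open>k2 + p + 2 \<le> n\<close>, including the loss of one from
    rounding \<open>k2\<close> up, and keeps the denominator \<open>d * n - 2 - p\<close>
    positive.\<close>
  have "\<forall>\<^sub>F n in sequentially. real p + 3 \<le> d * real n"
  proof -
    have "\<forall>\<^sub>F n in sequentially. (real p + 3) / d \<le> real n"
      by (rule eventually_nat_real[OF eventually_ge_at_top])
    then show ?thesis by eventually_elim (use d in \<open>simp add: field_simps\<close>)
  qed
  with order_tendstoD(2)[OF tail_bounds_tendsto(1)[OF c d] p(1)]
    order_tendstoD(2)[OF tail_bounds_tendsto(2)[OF c d] p(2)] eventually_ge_at_top[of 2]
  show "\<forall>\<^sub>F n in sequentially. a < ?P n (?good n)"
  proof eventually_elim
    case (elim n)
    let ?len = "\<lambda>f. path_length (greedy_path n f (v n))"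
    note bounds = prob_path_length_bounds[OF v[of n] \<open>2 \<le> n\<close> p(3)]
    define k1 k2 where "k1 = nat \<lceil>(1 - c) * real n\<rceil>" and "k2 = nat \<lceil>(1 - d) * real n\<rceil>"
    have "1 - d > 0"
    proof -
      have "2 \<le> (exp 1 :: real)" using exp_ge_add_one_self[of 1] by simp
      then have "1 / (exp 1 :: real) \<le> 1 / 2" by (intro divide_left_mono) auto
      then show ?thesis using \<epsilon> unfolding d_def by linarith
    qed
    then have "0 \<le> (1 - d) * real n" by (intro mult_nonneg_nonneg) linarith+
    then have "0 \<le> \<lceil>(1 - d) * real n\<rceil>" using le_of_int_ceiling order_trans by fastforce
    then have "real k2 = of_int \<lceil>(1 - d) * real n\<rceil>" unfolding k2_def by (rule of_nat_nat)
    then have k2: "k2 \<le> (1 - d) * real n + 1" using of_int_ceiling_le_add_one by metis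
    have k1: "(1 - c) * real n \<le> k1" unfolding k1_def by (rule real_nat_ceiling_ge)
    have "?P n {f. k1 \<le> ?len f} \<le> 2 * (exp (real p + 2) * (real (n - 1 - k1 + p) / real (n - 1 + p)) ^ p)"
      using bounds(1)[of k1] elim by simp
    also have "\<dots> \<le> 2 * (exp (real p + 2) * ((c * real n + real p) / (real n - 1 + real p)) ^ p)"
    proof -
      have "real (n - 1 - k1) \<le> c * real n"
      proof (cases "n - 1 \<le> k1")
        case False
        then have "real (n - 1 - k1) = real n - 1 - real k1" using elim by (simp add: of_nat_diff)
        then show ?thesis using k1 by (simp add: algebra_simps)
      qed (use c in simp)
      then have "real (n - 1 - k1 + p) / real (n - 1 + p) \<le> (c * real n + real p) / (real n - 1 + real p)"
        using elim by (intro frac_le) (auto simp: of_nat_diff)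
      then show ?thesis by (intro mult_left_mono power_mono) auto
    qed
    finally have upper: "?P n {f. k1 \<le> ?len f} < \<eta> / 2" using elim by simp
    have "real (k2 + p + 2) \<le> real n"
      using k2 elim by (simp add: algebra_simps)
    then have kp: "k2 + p + 2 \<le> n" by linarith
    then have "?P n {f. \<not> k2 \<le> ?len f} \<le> 2 * (exp (- real p) * (real (n - 1 - p) / real (n - 1 - p - k2)) ^ p)"
      using bounds(2)[of k2] elim by simp
    also have "\<dots> \<le> 2 * (exp (- real p) * (real n / (d * real n - 2 - real p)) ^ p)"
    proof -
      have "real (n - 1 - p - k2) = real n - 1 - real p - real k2" using kp by (simp add: of_nat_diff)
      then have "d * real n - 2 - real p \<le> real (n - 1 - p - k2)" using k2 by (simp add: algebra_simps)
      then have "real (n - 1 - p) / real (n - 1 - p - k2) \<le> real n / (d * real n - 2 - real p)"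
        using elim by (intro frac_le) auto
      then show ?thesis by (intro mult_left_mono power_mono) auto
    qed
    finally have lower: "?P n {f. \<not> k2 \<le> ?len f} < \<eta> / 2" using elim by simp
    have "- ?good n \<subseteq> {f. k1 \<le> ?len f} \<union> {f. \<not> k2 \<le> ?len f}"
    proof
      fix f assume "f \<in> - ?good n"
      then have "real (?len f) > (1 - c) * real n \<or> real (?len f) < (1 - d) * real n"
        by (auto simp: abs_if c_def d_def algebra_simps split: if_splits)
      then have "k1 \<le> ?len f \<or> \<not> k2 \<le> ?len f"
        using real_nat_ceiling_ge[of "(1 - d) * real n"]
        unfolding k1_def nat_ceiling_le_eq k2_def not_le by linarith
      then show "f \<in> {f. k1 \<le> ?len f} \<union> {f. \<not> k2 \<le> ?len f}" by simp
    qed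
    then have "?P n (- ?good n) \<le> ?P n ({f. k1 \<le> ?len f} \<union> {f. \<not> k2 \<le> ?len f})"
      by (intro measure_pmf.finite_measure_mono) auto
    also have "\<dots> \<le> ?P n {f. k1 \<le> ?len f} + ?P n {f. \<not> k2 \<le> ?len f}"
      by (rule measure_Un_le) auto
    also have "\<dots> < \<eta>" using upper lower by simp
    also have "?P n (- ?good n) = 1 - ?P n (?good n)"
      using measure_pmf.prob_compl[of "?good n" "pmf_of_set (edge_orderings n)"] by (simp add: Compl_eq_Diff_UNIV)
    finally show ?case by (simp add: \<eta>_def)
  qed
qed

theorem proposition1:
  fixes v0 :: "nat \<Rightarrow> nat"
  assumes "\<And>n. n \<ge> 1 \<Longrightarrow> v0 n < n"
  shows "\<exists>\<delta> :: nat \<Rightarrow> real. \<delta> \<in> o(\<lambda>_. 1) \<and>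
    (\<lambda>n. measure_pmf.prob (pmf_of_set (edge_orderings n))
       {f. \<bar>real (path_length (greedy_path n f (v0 n))) - (1 - 1 / exp 1) * real n\<bar>
             \<le> \<delta> n * real n}) \<longlonglongrightarrow> 1"
proof -
  define P where "P n \<epsilon> = measure_pmf.prob (pmf_of_set (edge_orderings n))
    {f. \<bar>real (path_length (greedy_path n f (v0 n))) - (1 - 1 / exp 1) * real n\<bar> \<le> \<epsilon> * real n}" for n \<epsilon>
  have mono: "mono (P n)" for n
    unfolding P_def
  proof (intro monoI measure_pmf.finite_measure_mono Collect_mono impI)
    fix x y :: real and f
    assume "x \<le> y"
    then have "x * real n \<le> y * real n" by (intro mult_right_mono) auto
    moreover assume "\<bar>real (path_length (greedy_path n f (v0 n))) - (1 - 1 / exp 1) * real n\<bar> \<le> x * real n"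
    ultimately show "\<bar>real (path_length (greedy_path n f (v0 n))) - (1 - 1 / exp 1) * real n\<bar> \<le> y * real n"
      by (rule order_trans[rotated])
  qed simp
  have "(\<lambda>n. P n \<epsilon>) \<longlonglongrightarrow> 1" if "0 < \<epsilon>" for \<epsilon>
  \<comment> \<open>Concentration was shown for tolerances up to 1/4; larger ones follow by
    monotonicity.\<close>
  proof (rule tendsto_sandwich)
    show "(\<lambda>n. P n (min \<epsilon> (1 / 4))) \<longlonglongrightarrow> 1"
      unfolding P_def using that by (intro prob_path_length_concentration assms) auto
    show "\<forall>\<^sub>F n in sequentially. P n (min \<epsilon> (1 / 4)) \<le> P n \<epsilon>"
      by (intro always_eventually allI monoD[OF mono]) simp
    show "\<forall>\<^sub>F n in sequentially. P n \<epsilon> \<le> 1" by (simp add: P_def)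
  qed (rule tendsto_const)
  then have "\<exists>\<delta>. \<delta> \<in> o(\<lambda>_. 1) \<and> (\<lambda>n. P n (\<delta> n)) \<longlonglongrightarrow> 1"
    by (intro exists_vanishing_tolerance mono) (simp_all add: P_def)
  then show ?thesis by (simp add: P_def)
qed

end
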